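(* Let $R$ be a Lie conformal superalgebra, $M$ a conformal module of $R$ with representation $\rho$, and let $\mathbf{d}$ be the differential on cochains of $R$ with coefficients in $M$. For every $n\in\mathbb{Z}_+$ and every $n$-cochain $\gamma$, $\mathbf{d}\gamma$ is a cochain (an $(n+1)$-cochain), and $\mathbf{d}^2=0$.
   Context: Everything is over $\mathbb{C}$; $\mathbb{Z}_+$ is the set of nonnegative integers. Degrees $|a|$ lie in $\mathbb{Z}_2$; whenever $|a|$ occurs, $a$ is homogeneous, and formulas are extended linearly. All $\mathbb{Z}_2$-graded $\mathbb{C}[\partial]$-modules are finitely generated. A Lie conformal superalgebra is a $\mathbb{Z}_2$-graded $\mathbb{C}[\partial]$-module $R=R_{\bar0}\oplus R_{\bar1}$ with a $\mathbb{C}$-bilinear map $R\times R\to R[\lambda]$, $(a,b)\mapsto[a_\lambda b]$, compatible with the grading, such that (C1) $[(\partial a)_\lambda b]=-\lambda[a_\lambda b]$; (C2) $[a_\lambda b]=-(-1)^{|a||b|}[b_{-\partial-\lambda}a]$ (on the right, $\nu=-\partial-\lambda$ is substituted into $[b_\nu a]=\sum_n\nu^nc_n$ with $\partial$ acting on the $c_n$); (C3) $[a_\lambda[b_\mu c]]=[[a_\lambda b]_{\lambda+\mu}c]+(-1)^{|a||b|}[b_\mu[a_\lambda c]]$. A conformal module $M$ of $R$ is a $\mathbb{Z}_2$-graded $\mathbb{C}[\partial]$-module with a degree-preserving linear map $a\mapsto\rho(a)_\lambda$, where $\rho(a)_\lambda:M\to M[\lambda]$ is $\mathbb{C}$-linear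 with $\rho(a)_\lambda\partial=(\partial+\lambda)\rho(a)_\lambda$ and $\rho(a)_\lambda(M_\mu)\subseteq M_{\mu+|a|}[\lambda]$, such that $\rho(\partial a)_\lambda=-\lambda\rho(a)_\lambda$ and $\rho(a)_\lambda\rho(b)_\mu-(-1)^{|a||b|}\rho(b)_\mu\rho(a)_\lambda=\rho([a_\lambda b])_{\lambda+\mu}$. An $n$-cochain of degree $\theta=|\gamma|$ of $R$ with coefficients in $M$ is a $\mathbb{C}$-multilinear map $\gamma$, of degree $\theta$ with respect to the $\mathbb{Z}_2$-gradings, $(a_1,\dots,a_n)\mapsto\gamma_{\lambda_1,\dots,\lambda_n}(a_1,\dots,a_n)\in M[\lambda_1,\dots,\lambda_n]$, satisfying (conformal antilinearity) $\gamma_{\lambda_1,\dots,\lambda_n}(a_1,\dots,\partial a_i,\dots,a_n)=-\lambda_i\gamma_{\lambda_1,\dots,\lambda_n}(a_1,\dots,a_i,\dots,a_n)$ for each $i$; (skew-symmetry) $\gamma_{\dots,\lambda_i,\lambda_{i+1},\dots}(\dots,a_i,a_{i+1},\dots)=-(-1)^{|a_i||a_{i+1}|}\gamma_{\dots,\lambda_{i+1},\lambda_i,\dots}(\dots,a_{i+1},a_i,\dots)$ for each $i$. A $0$-cochain is an element of $M$. The differential is $$(\mathbf{d}\gamma)_{\lambda_1,\dots,\lambda_{n+1}}(a_1,\dots,a_{n+1})=\sum_{i=1}^{n+1}(-1)^{i+1}(-1)^{(|\gamma|+|a_1|+\cdots+|a_{i-1}|)|a_i|}\rho(a_i)_{\lambda_i}\gamma_{\lambda_1,\dots,\hat{\lambda_i},\dots,\lambda_{n+1}}(a_1,\dots,\hat{a_i},\dots,a_{n+1})$$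 $$+\sum_{1\le i<j\le n+1}(-1)^{i+j}(-1)^{(|a_1|+\cdots+|a_{i-1}|)|a_i|+(|a_1|+\cdots+|a_{j-1}|)|a_j|+|a_i||a_j|}\gamma_{\lambda_i+\lambda_j,\lambda_1,\dots,\hat{\lambda_i},\dots,\hat{\lambda_j},\dots,\lambda_{n+1}}([{a_i}_{\lambda_i}a_j],a_1,\dots,\hat{a_i},\dots,\hat{a_j},\dots,a_{n+1}),$$ where hats denote omission, and $\gamma$ and $\rho(a_i)_{\lambda_i}$ are extended linearly over polynomials in the $\lambda_i$. For a $0$-cochain $\gamma\in M$ this reads $(\mathbf{d}\gamma)_\lambda(a)=(-1)^{|\gamma||a|}\rho(a)_\lambda\gamma$. *)

theory Defs
  imports "HOL-Computational_Algebra.Polynomial" "HOL-Library.Poly_Mapping" "HOL-Library.Z2"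
begin

section \<open>Polynomials with coefficients in a module\<close>

text \<open>
  A complex vector space with an endomorphism \<open>\<partial>\<close> is given as a module over \<open>\<complex>[\<partial>]\<close>,
  with scalar multiplication \<open>sm :: complex poly \<Rightarrow> 'x \<Rightarrow> 'x\<close>; thus \<open>sm [:c:]\<close> is multiplication
  by the number \<open>c\<close> and \<open>sm [:0, 1:]\<close> is \<open>\<partial>\<close>.  The polynomials \<open>X[\<lambda>]\<close> in one variable are
  \<open>'x poly\<close>; the polynomials in the variables \<open>\<lambda>\<^sub>0, \<lambda>\<^sub>1, \<dots>\<close> are the following type, where a
  monomial is a finitely supported exponent function.
\<close>

type_synonym 'x mpoly = "(nat \<Rightarrow>\<^sub>0 nat) \<Rightarrow>\<^sub>0 'x"

definition cst :: "'x::zero \<Rightarrow> 'x mpoly" where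
  "cst x = Poly_Mapping.single 0 x"

definition mon :: "(nat \<Rightarrow>\<^sub>0 nat) \<Rightarrow> complex mpoly" where
  "mon k = Poly_Mapping.single k 1"

definition var :: "nat \<Rightarrow> complex mpoly" where
  "var i = mon (Poly_Mapping.single i 1)"

definition mpolys_in :: "nat \<Rightarrow> 'x::zero mpoly set" where
  "mpolys_in n = {P. \<forall>k \<in> Poly_Mapping.keys P. Poly_Mapping.keys k \<subseteq> {..<n}}"

text \<open>The action of \<open>\<complex>[\<lambda>\<^sub>0, \<lambda>\<^sub>1, \<dots>]\<close> on \<open>X[\<lambda>\<^sub>0, \<lambda>\<^sub>1, \<dots>]\<close>.\<close>

definition mscale ::
  "(complex poly \<Rightarrow> 'x::ab_group_add \<Rightarrow> 'x) \<Rightarrow> complex mpoly \<Rightarrow> 'x mpoly \<Rightarrow> 'x mpoly" where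
  "mscale sm Q P = (\<Sum>k \<in> Poly_Mapping.keys Q. \<Sum>l \<in> Poly_Mapping.keys P.
     Poly_Mapping.single (k + l) (sm [:Poly_Mapping.lookup Q k:] (Poly_Mapping.lookup P l)))"

text \<open>The substitution of the polynomials \<open>s 0, s 1, \<dots>\<close> for \<open>\<lambda>\<^sub>0, \<lambda>\<^sub>1, \<dots>\<close>.\<close>

definition msubst ::
  "(complex poly \<Rightarrow> 'x::ab_group_add \<Rightarrow> 'x) \<Rightarrow> (nat \<Rightarrow> complex mpoly) \<Rightarrow> 'x mpoly \<Rightarrow> 'x mpoly" where
  "msubst sm s P = (\<Sum>k \<in> Poly_Mapping.keys P.
     mscale sm (\<Prod>v \<in> Poly_Mapping.keys k. s v ^ Poly_Mapping.lookup k v)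
       (cst (Poly_Mapping.lookup P k)))"

text \<open>
  Extension of \<open>f :: 'x \<Rightarrow> Y[\<lambda>\<^sub>0, \<lambda>\<^sub>1, \<dots>]\<close> to polynomials in one variable with value \<open>q\<close>:
  \<open>\<Sum>\<^sub>n \<nu>\<^sup>n x\<^sub>n\<close> goes to \<open>\<Sum>\<^sub>n q\<^sup>n f(x\<^sub>n)\<close>.  With \<open>f = cst\<close> it is the substitution of \<open>q\<close> for \<open>\<nu>\<close>.
\<close>

definition pextend ::
  "(complex poly \<Rightarrow> 'y::ab_group_add \<Rightarrow> 'y) \<Rightarrow> complex mpoly \<Rightarrow> ('x::zero \<Rightarrow> 'y mpoly)
    \<Rightarrow> 'x poly \<Rightarrow> 'y mpoly" where
  "pextend sm q f p = (\<Sum>n\<le>Polynomial.degree p. mscale sm (q ^ n) (f (poly.coeff p n)))"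

text \<open>Substitution of \<open>-\<partial> - \<lambda>\<close> for the variable, with \<open>\<partial>\<close> acting on the coefficients.\<close>

definition neg_del_lam :: "(complex poly \<Rightarrow> 'x::ab_group_add \<Rightarrow> 'x) \<Rightarrow> 'x poly \<Rightarrow> 'x poly" where
  "neg_del_lam sm p = - map_poly (sm [:0, 1:]) p - pCons 0 p"

definition subst_neg_del_lam ::
  "(complex poly \<Rightarrow> 'x::ab_group_add \<Rightarrow> 'x) \<Rightarrow> 'x poly \<Rightarrow> 'x poly" where
  "subst_neg_del_lam sm p =
     (\<Sum>n\<le>Polynomial.degree p. (neg_del_lam sm ^^ n) [:poly.coeff p n:])"


section \<open>Lie conformal superalgebras and conformal modules\<close>

text \<open>Degrees are elements of the two-element field \<open>bit\<close>; \<open>sgn_if e x\<close> is \<open>(-1)\<^sup>e x\<close>.\<close>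

definition sgn_if :: "bit \<Rightarrow> 'x::ab_group_add \<Rightarrow> 'x" where
  "sgn_if e x = (if e = 0 then x else - x)"

locale graded_module = module sm
  for sm :: "complex poly \<Rightarrow> 'x::ab_group_add \<Rightarrow> 'x" +
  fixes G :: "bit \<Rightarrow> 'x set"
  assumes subspace_G: "subspace (G e)"
    and G_Int: "G 0 \<inter> G 1 = {0}"
    and G_sum: "\<exists>y \<in> G 0. \<exists>z \<in> G 1. x = y + z"
    and finitely_generated: "\<exists>S. finite S \<and> span S = UNIV"

definition hcomp :: "(bit \<Rightarrow> 'x::ab_group_add set) \<Rightarrow> bit \<Rightarrow> 'x \<Rightarrow> 'x" where
  "hcomp G e x = (THE y. y \<in> G e \<and> x - y \<in> G (e + 1))"

locale lie_conformal_superalgebra = graded_module sm G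
  for sm :: "complex poly \<Rightarrow> 'r::ab_group_add \<Rightarrow> 'r" and G :: "bit \<Rightarrow> 'r set" +
  fixes br :: "'r \<Rightarrow> 'r \<Rightarrow> 'r poly"
  assumes br_add_left: "br (a + a') b = br a b + br a' b"
    and br_add_right: "br a (b + b') = br a b + br a b'"
    and br_scale_left: "br (sm [:z:] a) b = map_poly (sm [:z:]) (br a b)"
    and br_scale_right: "br a (sm [:z:] b) = map_poly (sm [:z:]) (br a b)"
    and br_graded: "a \<in> G d \<Longrightarrow> b \<in> G e \<Longrightarrow> poly.coeff (br a b) n \<in> G (d + e)"
    and C1: "br (sm [:0, 1:] a) b = - pCons 0 (br a b)"
    and C2: "a \<in> G d \<Longrightarrow> b \<in> G e \<Longrightarrow> br a b = - sgn_if (d * e) (subst_neg_del_lam sm (br b a))"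
    \<comment> \<open>In C3, \<open>\<lambda>\<close> is \<open>var 0\<close> and \<open>\<mu>\<close> is \<open>var 1\<close>.\<close>
    and C3: "a \<in> G d \<Longrightarrow> b \<in> G e \<Longrightarrow>
      pextend sm (var 1) (\<lambda>x. pextend sm (var 0) cst (br a x)) (br b c) =
      pextend sm (var 0) (\<lambda>x. pextend sm (var 0 + var 1) cst (br x c)) (br a b) +
      sgn_if (d * e) (pextend sm (var 0) (\<lambda>x. pextend sm (var 1) cst (br b x)) (br a c))"

locale conformal_module =
  R: lie_conformal_superalgebra smR GR br + M: graded_module smM GM
  for smR :: "complex poly \<Rightarrow> 'r::ab_group_add \<Rightarrow> 'r" and GR :: "bit \<Rightarrow> 'r set"
    and br :: "'r \<Rightarrow> 'r \<Rightarrow> 'r poly"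
    and smM :: "complex poly \<Rightarrow> 'm::ab_group_add \<Rightarrow> 'm" and GM :: "bit \<Rightarrow> 'm set" +
  fixes rho :: "'r \<Rightarrow> 'm \<Rightarrow> 'm poly"
  assumes rho_add_left: "rho (a + a') m = rho a m + rho a' m"
    and rho_add_right: "rho a (m + m') = rho a m + rho a m'"
    and rho_scale_left: "rho (smR [:z:] a) m = map_poly (smM [:z:]) (rho a m)"
    and rho_scale_right: "rho a (smM [:z:] m) = map_poly (smM [:z:]) (rho a m)"
    and rho_graded: "a \<in> GR d \<Longrightarrow> m \<in> GM e \<Longrightarrow> poly.coeff (rho a m) n \<in> GM (e + d)"
    and rho_del_right:
      "rho a (smM [:0, 1:] m) = map_poly (smM [:0, 1:]) (rho a m) + pCons 0 (rho a m)"
    and rho_del_left: "rho (smR [:0, 1:] a) m = - pCons 0 (rho a m)"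
    \<comment> \<open>Again \<open>\<lambda>\<close> is \<open>var 0\<close> and \<open>\<mu>\<close> is \<open>var 1\<close>.\<close>
    and rho_br: "a \<in> GR d \<Longrightarrow> b \<in> GR e \<Longrightarrow>
      pextend smM (var 1) (\<lambda>x. pextend smM (var 0) cst (rho a x)) (rho b m) -
      sgn_if (d * e) (pextend smM (var 0) (\<lambda>x. pextend smM (var 1) cst (rho b x)) (rho a m)) =
      pextend smM (var 0) (\<lambda>x. pextend smM (var 0 + var 1) cst (rho x m)) (br a b)"


section \<open>Cochains\<close>

text \<open>
  An \<open>n\<close>-cochain is a function on argument lists of length \<open>n\<close>, extended by \<open>0\<close> to lists of other
  lengths so that equality of cochains is equality of functions.  Arguments and variables are
  numbered from \<open>0\<close>, so \<open>\<gamma> [a\<^sub>0, \<dots>, a\<^sub>n\<^sub>-\<^sub>1]\<close> lies in \<open>M[\<lambda>\<^sub>0, \<dots>, \<lambda>\<^sub>n\<^sub>-\<^sub>1]\<close>; a \<open>0\<close>-cochain is determined by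
  its value at the empty list, a constant polynomial, that is, an element of \<open>M\<close>.
\<close>

type_synonym ('r, 'm) cochain = "'r list \<Rightarrow> 'm mpoly"

text \<open>\<open>cochain_at sm \<gamma> [q\<^sub>0, \<dots>] as\<close> is \<open>\<gamma>\<close> at \<open>as\<close> with \<open>q\<^sub>0, \<dots>\<close> substituted for the variables.\<close>

definition cochain_at :: "(complex poly \<Rightarrow> 'm::ab_group_add \<Rightarrow> 'm) \<Rightarrow> ('r, 'm) cochain
    \<Rightarrow> complex mpoly list \<Rightarrow> 'r list \<Rightarrow> 'm mpoly" where
  "cochain_at sm \<gamma> qs as = msubst sm (\<lambda>v. qs ! v) (\<gamma> as)"

text \<open>
  In the condition of skew-symmetry the two arguments are homogeneous of degrees \<open>d\<close>, \<open>e\<close>, and the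
  other arguments are arbitrary.
\<close>

definition hom_cochains :: "(complex poly \<Rightarrow> 'r::ab_group_add \<Rightarrow> 'r) \<Rightarrow> (bit \<Rightarrow> 'r set)
    \<Rightarrow> (complex poly \<Rightarrow> 'm::ab_group_add \<Rightarrow> 'm) \<Rightarrow> (bit \<Rightarrow> 'm set)
    \<Rightarrow> nat \<Rightarrow> bit \<Rightarrow> ('r, 'm) cochain set" where
  "hom_cochains smR GR smM GM n \<theta> = {\<gamma>.
     (\<forall>as. length as \<noteq> n \<longrightarrow> \<gamma> as = 0) \<and>
     (\<forall>as. length as = n \<longrightarrow> \<gamma> as \<in> mpolys_in n) \<and>
     (\<forall>as i x y. length as = n \<and> i < n \<longrightarrow>
        \<gamma> (as[i := x + y]) = \<gamma> (as[i := x]) + \<gamma> (as[i := y])) \<and>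
     (\<forall>as i c x. length as = n \<and> i < n \<longrightarrow>
        \<gamma> (as[i := smR [:c:] x]) = mscale smM (cst c) (\<gamma> (as[i := x]))) \<and>
     (\<forall>as es k. length as = n \<and> length es = n \<and> (\<forall>i<n. as ! i \<in> GR (es ! i)) \<longrightarrow>
        Poly_Mapping.lookup (\<gamma> as) k \<in> GM (\<theta> + sum_list es)) \<and>
     (\<forall>as i x. length as = n \<and> i < n \<longrightarrow>
        \<gamma> (as[i := smR [:0, 1:] x]) = - mscale smM (var i) (\<gamma> (as[i := x]))) \<and>
     (\<forall>as i d e. length as = n \<and> Suc i < n \<and> as ! i \<in> GR d \<and> as ! Suc i \<in> GR e \<longrightarrow>
        \<gamma> as = - sgn_if (d * e)
          (cochain_at smM \<gamma> ((map var [0..<n])[i := var (Suc i), Suc i := var i])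
             (as[i := as ! Suc i, Suc i := as ! i])))}"

definition cochains :: "(complex poly \<Rightarrow> 'r::ab_group_add \<Rightarrow> 'r) \<Rightarrow> (bit \<Rightarrow> 'r set)
    \<Rightarrow> (complex poly \<Rightarrow> 'm::ab_group_add \<Rightarrow> 'm) \<Rightarrow> (bit \<Rightarrow> 'm set)
    \<Rightarrow> nat \<Rightarrow> ('r, 'm) cochain set" where
  "cochains smR GR smM GM n =
     {\<lambda>as. \<gamma>0 as + \<gamma>1 as |\<gamma>0 \<gamma>1.
        \<gamma>0 \<in> hom_cochains smR GR smM GM n 0 \<and> \<gamma>1 \<in> hom_cochains smR GR smM GM n 1}"


section \<open>The differential\<close>

definition omit :: "nat \<Rightarrow> 'x list \<Rightarrow> 'x list" where
  "omit i xs = take i xs @ drop (Suc i) xs"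

definition rho_ext :: "(complex poly \<Rightarrow> 'm::ab_group_add \<Rightarrow> 'm) \<Rightarrow> ('r \<Rightarrow> 'm \<Rightarrow> 'm poly)
    \<Rightarrow> 'r \<Rightarrow> complex mpoly \<Rightarrow> 'm mpoly \<Rightarrow> 'm mpoly" where
  "rho_ext smM rho a q P = (\<Sum>k \<in> Poly_Mapping.keys P.
     mscale smM (mon k) (pextend smM q cst (rho a (Poly_Mapping.lookup P k))))"

text \<open>
  The formula for \<open>d\<gamma>\<close> where \<open>\<gamma>\<close> is homogeneous of degree \<open>\<theta>\<close> and the arguments \<open>as\<close> are
  homogeneous of degrees \<open>es\<close>.  Since numbering starts at \<open>0\<close>, the usual \<open>(-1)\<^sup>i\<^sup>+\<^sup>1\<close> becomes \<open>(-1)\<^sup>i\<close>,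
  while \<open>(-1)\<^sup>i\<^sup>+\<^sup>j\<close> is unchanged.
\<close>

definition hom_differential :: "('r \<Rightarrow> 'r \<Rightarrow> 'r::ab_group_add poly)
    \<Rightarrow> (complex poly \<Rightarrow> 'm::ab_group_add \<Rightarrow> 'm) \<Rightarrow> ('r \<Rightarrow> 'm \<Rightarrow> 'm poly)
    \<Rightarrow> bit \<Rightarrow> bit list \<Rightarrow> ('r, 'm) cochain \<Rightarrow> ('r, 'm) cochain" where
  "hom_differential br smM rho \<theta> es \<gamma> as =
     (let N = length as; ls = map var [0..<N]; s = (\<lambda>i. sum_list (take i es)) in
      (\<Sum>i<N. sgn_if (of_nat i + (\<theta> + s i) * es ! i)
         (rho_ext smM rho (as ! i) (var i) (cochain_at smM \<gamma> (omit i ls) (omit i as)))) +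
      (\<Sum>j<N. \<Sum>i<j. sgn_if (of_nat (i + j) + s i * es ! i + s j * es ! j + es ! i * es ! j)
         (pextend smM (var i)
            (\<lambda>x. cochain_at smM \<gamma> ((var i + var j) # omit i (omit j ls)) (x # omit i (omit j as)))
            (br (as ! i) (as ! j)))))"

text \<open>
  The component of degree \<open>\<theta>\<close> of a multilinear map: on arguments of degrees \<open>es\<close> it is the
  component of degree \<open>\<theta> + sum_list es\<close> of the value.
\<close>

definition cochain_comp :: "(bit \<Rightarrow> 'r::ab_group_add set) \<Rightarrow> (bit \<Rightarrow> 'm::ab_group_add set)
    \<Rightarrow> bit \<Rightarrow> ('r, 'm) cochain \<Rightarrow> ('r, 'm) cochain" where
  "cochain_comp GR GM \<theta> \<gamma> as = (\<Sum>es | length es = length as.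
     Poly_Mapping.map (hcomp GM (\<theta> + sum_list es)) (\<gamma> (map2 (hcomp GR) es as)))"

text \<open>The linear extension of the formula to arbitrary \<open>\<gamma>\<close> and arbitrary arguments.\<close>

definition differential :: "(bit \<Rightarrow> 'r::ab_group_add set) \<Rightarrow> ('r \<Rightarrow> 'r \<Rightarrow> 'r poly)
    \<Rightarrow> (complex poly \<Rightarrow> 'm::ab_group_add \<Rightarrow> 'm) \<Rightarrow> (bit \<Rightarrow> 'm set) \<Rightarrow> ('r \<Rightarrow> 'm \<Rightarrow> 'm poly)
    \<Rightarrow> ('r, 'm) cochain \<Rightarrow> ('r, 'm) cochain" where
  "differential GR br smM GM rho \<gamma> as =
     (\<Sum>\<theta> \<in> {0, 1}. \<Sum>es | length es = length as.
        hom_differential br smM rho \<theta> es (cochain_comp GR GM \<theta> \<gamma>) (map2 (hcomp GR) es as))"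

lemma finite_degree_lists: "finite {es :: bit list. length es = n}"
proof -
  have "{es :: bit list. length es = n} = {es. set es \<subseteq> {0, 1} \<and> length es = n}"
    by (auto intro: bit.exhaust)
  then show ?thesis
    by (simp add: finite_lists_length_eq)
qed

end

theory Submission
  imports Defs
begin

text \<open>
  Cartan calculus.  Evaluate a cochain not only at the variables but at pairs \<open>(a, q)\<close> of a
  homogeneous element and a polynomial \<open>q\<close> substituted for its variable.  These pairs behave like a
  Lie superalgebra over \<open>\<complex>[\<lambda>\<^sub>0, \<lambda>\<^sub>1, \<dots>]\<close> with bracket
  \<open>[(a, q), (b, r)] = ([a\<^sub>q b], q + r)\<close>, where \<open>(\<partial>a, q)\<close> is identified with \<open>-q (a, q)\<close>: C2 with
  \<open>-\<partial> - \<lambda>\<close> becomes ordinary super skew-symmetry and C3 the Jacobi identity.  For skew cochains the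
  formula for \<open>\<^bold>d\<close> is equivalent to the recursion \<open>\<iota>\<^sub>a \<^bold>d = L\<^sub>a - \<^bold>d \<iota>\<^sub>a\<close>, where \<open>\<iota>\<^sub>a\<close> inserts \<open>a\<close> as first
  argument and the Lie derivative satisfies \<open>\<iota>\<^sub>b L\<^sub>a = \<plusminus> L\<^sub>a \<iota>\<^sub>b - \<iota>\<^bsub>[a,b]\<^esub>\<close>.  Induction on the number of
  arguments then gives successively \<open>[L\<^sub>a, L\<^sub>b] = L\<^bsub>[a,b]\<^esub>\<close>, \<open>[L\<^sub>a, \<^bold>d] = 0\<close> and \<open>\<^bold>d\<^sup>2 = 0\<close>, and likewise
  the skew-symmetry, linearity and grading of \<open>\<^bold>d\<gamma>\<close>.
\<close>

text \<open>A \<lambda>-action takes values in polynomials, so inside the module two actions cannot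
  even be composed. Once each argument carries a polynomial, \<open>\<rho>\<close> is an
  endomorphism of the polynomials over M, linear over scalar polynomials, and the calculus has no
  correction terms. The bracket is never formed as an element: only its image
  \<open>Br a b f\<close> under a function f occurs, and the bracket identities are required only
  for those f that respect \<partial>. Degrees cannot be read off elements, since 0 has both. They
  are therefore carried along: as a tag of each argument, and as a parameter \<theta> for the
  function, which changes by the degree of every inserted argument. Skew-symmetry of the cochain
  enters where the recursion is compared with the explicit formula, in which brackets stand in the
  first slot, and in the skew-symmetry of the result. The Cartan relations and the vanishing of the
  square rest on multilinearity. Applying the differential twice requires values at pairs again,
  hence the lemmas that the recursion commutes with substitution.\<close>

text \<open>
  These simplification rules turn sums and products of degrees into bit operations, which have no
  ring normal form.
\<close>

declare add_bit_eq_xor [simp del] mult_bit_eq_and [simp del]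

section \<open>Signs, and lists with an omitted entry\<close>

lemma bit_add_cancel [simp]: "(x::bit) + x = 0" "x + (x + y) = y"
  by (cases x; simp)+

lemma bit_uminus [simp]: "- (x::bit) = x"
  by (cases x; simp)

lemma sgn_if_zero [simp]: "sgn_if e 0 = 0"
  by (simp add: sgn_if_def)

lemma sgn_if_0 [simp]: "sgn_if 0 x = x"
  by (simp add: sgn_if_def)

lemma sgn_if_add: "sgn_if e (x + y) = sgn_if e x + sgn_if e y"
  by (simp add: sgn_if_def)

lemma sgn_if_uminus: "sgn_if e (- x) = - sgn_if e x"
  by (simp add: sgn_if_def)

lemma sgn_if_diff: "sgn_if e (x - y) = sgn_if e x - sgn_if e y"
  by (simp add: sgn_if_def)

lemma sgn_if_sgn_if [simp]: "sgn_if d (sgn_if e x) = sgn_if (d + e) x"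
  by (cases d; cases e; simp add: sgn_if_def)

lemma sgn_if_Suc: "sgn_if (1 + e) x = - sgn_if e x"
  by (cases e; simp add: sgn_if_def)

lemma sgn_if_sum: "sgn_if e (\<Sum>i\<in>I. f i) = (\<Sum>i\<in>I. sgn_if e (f i))"
  by (simp add: sgn_if_def sum_negf)

lemma sgn_if_in: "(\<And>u. u \<in> S \<Longrightarrow> - u \<in> S) \<Longrightarrow> u \<in> S \<Longrightarrow> sgn_if e u \<in> S"
  by (simp add: sgn_if_def)

lemma omit_Cons [simp]: "omit 0 (x # xs) = xs" "omit (Suc i) (x # xs) = x # omit i xs"
  by (simp_all add: omit_def)

lemma omit_map: "omit i (map f xs) = map f (omit i xs)"
  by (simp add: omit_def take_map drop_map)

lemma set_omit: "set (omit i xs) \<subseteq> set xs"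
  by (auto simp: omit_def dest: in_set_takeD in_set_dropD)

lemmas sgn_if_simps = sgn_if_add sgn_if_diff sgn_if_uminus

section \<open>Cartan calculus for Lie superalgebras\<close>

text \<open>The bracket of two pairs is a polynomial, and pairs are not added, hence the data
  \<open>idx\<close>, \<open>cf\<close>, \<open>el\<close> of a formal combination.
  \<open>\<rho>_act\<close> makes the representation linear over the scalars, so that it can be
  interchanged with \<open>Br\<close>. The degree is defined on all of \<open>'l\<close>;
  \<open>hom\<close> singles out the pairs whose element really has that degree.\<close>

locale super_cartan_ops =
  fixes deg :: "'l \<Rightarrow> bit" and hom :: "'l set"
    and idx :: "'l \<Rightarrow> 'l \<Rightarrow> nat set" and cf :: "'l \<Rightarrow> 'l \<Rightarrow> nat \<Rightarrow> 's"
    and el :: "'l \<Rightarrow> 'l \<Rightarrow> nat \<Rightarrow> 'l"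
    and act :: "'s \<Rightarrow> 'v::ab_group_add \<Rightarrow> 'v" and \<rho> :: "'l \<Rightarrow> 'v \<Rightarrow> 'v"
  assumes act_add: "act c (u + v) = act c u + act c v"
    and act_commute: "act c (act d v) = act d (act c v)"
    and \<rho>_add: "\<rho> a (u + v) = \<rho> a u + \<rho> a v"
    and \<rho>_act: "\<rho> a (act c v) = act c (\<rho> a v)"
    and deg_el: "deg (el a b i) = deg a + deg b"
    and el_hom: "a \<in> hom \<Longrightarrow> b \<in> hom \<Longrightarrow> el a b i \<in> hom"
begin

text \<open>\<open>Br a b f\<close> stands for \<open>f [a, b]\<close>, where \<open>[a, b]\<close> is a formal combination of the \<open>el a b i\<close> with coefficients \<open>cf a b i\<close>.\<close>

definition Br :: "'l \<Rightarrow> 'l \<Rightarrow> ('l \<Rightarrow> 'v) \<Rightarrow> 'v" where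
  "Br a b f = (\<Sum>i\<in>idx a b. act (cf a b i) (f (el a b i)))"

text \<open>\<open>\<theta>\<close> is the degree of F and has to be a parameter, because inserting
  b leaves a function of degree \<open>\<theta> + deg b\<close>. Unfolded, the signs
  \<open>deg a * deg b\<close> cancel those produced by the growth of \<open>\<theta>\<close>, so
  that \<open>\<rho> a\<close> keeps only the sign of moving a past F.\<close>

fun Lie :: "bit \<Rightarrow> 'l \<Rightarrow> ('l list \<Rightarrow> 'v) \<Rightarrow> 'l list \<Rightarrow> 'v" where
  "Lie \<theta> a F [] = sgn_if (\<theta> * deg a) (\<rho> a (F []))"
| "Lie \<theta> a F (b # bs) =
     sgn_if (deg a * deg b) (Lie (\<theta> + deg b) a (\<lambda>xs. F (b # xs)) bs) - Br a b (\<lambda>x. F (x # bs))"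

fun Dif :: "bit \<Rightarrow> ('l list \<Rightarrow> 'v) \<Rightarrow> 'l list \<Rightarrow> 'v" where
  "Dif \<theta> F [] = 0"
| "Dif \<theta> F (a # as) = Lie \<theta> a F as - Dif (\<theta> + deg a) (\<lambda>xs. F (a # xs)) as"

section \<open>Linearity of the operators\<close>

lemma additive_act: "additive (act c)"
  by (simp add: additive_def act_add)

lemma additive_\<rho>: "additive (\<rho> a)"
  by (simp add: additive_def \<rho>_add)

lemmas act_simps = additive.zero[OF additive_act] additive.minus[OF additive_act]
  additive.diff[OF additive_act] additive.sum[OF additive_act]

lemmas \<rho>_simps = additive.zero[OF additive_\<rho>] additive.minus[OF additive_\<rho>]
  additive.diff[OF additive_\<rho>] additive.sum[OF additive_\<rho>]

lemma act_sgn: "act c (sgn_if e v) = sgn_if e (act c v)"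
  by (simp add: sgn_if_def act_simps)

lemma \<rho>_sgn: "\<rho> a (sgn_if e v) = sgn_if e (\<rho> a v)"
  by (simp add: sgn_if_def \<rho>_simps)

lemma Br_add: "Br a b (\<lambda>x. f x + g x) = Br a b f + Br a b g"
  by (simp add: Br_def act_add sum.distrib)

lemma Br_zero [simp]: "Br a b (\<lambda>x. 0) = 0"
  by (simp add: Br_def act_simps)

lemma Br_uminus: "Br a b (\<lambda>x. - f x) = - Br a b f"
  by (simp add: Br_def act_simps sum_negf)

lemma Br_diff: "Br a b (\<lambda>x. f x - g x) = Br a b f - Br a b g"
  by (simp add: Br_def act_simps sum_subtractf)

lemma Br_sgn: "Br a b (\<lambda>x. sgn_if e (f x)) = sgn_if e (Br a b f)"
  by (simp add: sgn_if_def Br_uminus)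

lemma Br_act: "Br a b (\<lambda>x. act c (f x)) = act c (Br a b f)"
  by (simp add: Br_def act_simps act_commute)

text \<open>Allows signs that depend on \<open>deg x\<close> to be rewritten under
  \<open>Br\<close>, where x has the degree of the bracket.\<close>

lemma Br_cong:
  assumes "\<And>x. deg x = deg a + deg b \<Longrightarrow> (a \<in> hom \<Longrightarrow> b \<in> hom \<Longrightarrow> x \<in> hom) \<Longrightarrow> f x = g x"
  shows "Br a b f = Br a b g"
  unfolding Br_def by (intro sum.cong refl arg_cong[of _ _ "act _"] assms deg_el el_hom)

lemma Lie_add: "Lie \<theta> a (\<lambda>xs. F xs + G xs) as = Lie \<theta> a F as + Lie \<theta> a G as"
  by (induction as arbitrary: \<theta> F G) (simp_all add: \<rho>_add sgn_if_add Br_add)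

lemma Lie_zero [simp]: "Lie \<theta> a (\<lambda>xs. 0) as = 0"
  by (induction as arbitrary: \<theta>) (simp_all add: \<rho>_simps)

lemma Lie_uminus: "Lie \<theta> a (\<lambda>xs. - F xs) as = - Lie \<theta> a F as"
  using Lie_add[of \<theta> a F "\<lambda>xs. - F xs" as] by (simp add: eq_neg_iff_add_eq_0 add.commute)

lemma Lie_diff: "Lie \<theta> a (\<lambda>xs. F xs - G xs) as = Lie \<theta> a F as - Lie \<theta> a G as"
  using Lie_add[of \<theta> a F "\<lambda>xs. - G xs" as] by (simp add: Lie_uminus)

lemma Lie_sgn: "Lie \<theta> a (\<lambda>xs. sgn_if e (F xs)) as = sgn_if e (Lie \<theta> a F as)"
  by (simp add: sgn_if_def Lie_uminus)

lemma Lie_act: "Lie \<theta> a (\<lambda>xs. act c (F xs)) as = act c (Lie \<theta> a F as)"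
  by (induction as arbitrary: \<theta> F) (simp_all add: \<rho>_act act_sgn Br_act act_simps)

lemma Lie_sum: "Lie \<theta> a (\<lambda>xs. \<Sum>i\<in>I. F i xs) as = (\<Sum>i\<in>I. Lie \<theta> a (F i) as)"
  by (induction I rule: infinite_finite_induct) (simp_all add: Lie_add)

lemma Lie_Br: "Lie \<theta> a (\<lambda>xs. Br b c (\<lambda>x. F x xs)) as = Br b c (\<lambda>x. Lie \<theta> a (F x) as)"
  by (simp add: Br_def Lie_sum Lie_act)

lemma Dif_add: "Dif \<theta> (\<lambda>xs. F xs + G xs) as = Dif \<theta> F as + Dif \<theta> G as"
  by (induction as arbitrary: \<theta> F G) (simp_all add: Lie_add)

lemma Dif_zero [simp]: "Dif \<theta> (\<lambda>xs. 0) as = 0"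
  by (induction as arbitrary: \<theta>) simp_all

lemma Dif_uminus: "Dif \<theta> (\<lambda>xs. - F xs) as = - Dif \<theta> F as"
  using Dif_add[of \<theta> F "\<lambda>xs. - F xs" as] by (simp add: eq_neg_iff_add_eq_0 add.commute)

lemma Dif_diff: "Dif \<theta> (\<lambda>xs. F xs - G xs) as = Dif \<theta> F as - Dif \<theta> G as"
  using Dif_add[of \<theta> F "\<lambda>xs. - G xs" as] by (simp add: Dif_uminus)

lemma Dif_sgn: "Dif \<theta> (\<lambda>xs. sgn_if e (F xs)) as = sgn_if e (Dif \<theta> F as)"
  by (simp add: sgn_if_def Dif_uminus)

lemma Dif_act: "Dif \<theta> (\<lambda>xs. act c (F xs)) as = act c (Dif \<theta> F as)"
  by (induction as arbitrary: \<theta> F) (simp_all add: Lie_act act_simps)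

lemma Dif_sum: "Dif \<theta> (\<lambda>xs. \<Sum>i\<in>I. F i xs) as = (\<Sum>i\<in>I. Dif \<theta> (F i) as)"
  by (induction I rule: infinite_finite_induct) (simp_all add: Dif_add)

lemma Dif_Br: "Dif \<theta> (\<lambda>xs. Br b c (\<lambda>x. F x xs)) as = Br b c (\<lambda>x. Dif \<theta> (F x) as)"
  by (simp add: Br_def Dif_sum Dif_act)

section \<open>Congruence, closure and naturality\<close>

lemma Lie_cong:
  assumes "a \<in> hom" "set as \<subseteq> hom"
    and "\<And>bs. length bs = length as \<Longrightarrow> set bs \<subseteq> hom \<Longrightarrow> F bs = G bs"
  shows "Lie \<theta> a F as = Lie \<theta> a G as"
  using assms
proof (induction as arbitrary: \<theta> F G)
  case (Cons b bs)
  have "Br a b (\<lambda>x. F (x # bs)) = Br a b (\<lambda>x. G (x # bs))"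
    using Cons.prems by (intro Br_cong) auto
  moreover have "Lie (\<theta> + deg b) a (\<lambda>xs. F (b # xs)) bs = Lie (\<theta> + deg b) a (\<lambda>xs. G (b # xs)) bs"
    using Cons.prems by (intro Cons.IH) auto
  ultimately show ?case by simp
qed simp

lemma Dif_cong:
  assumes "set as \<subseteq> hom"
    and "\<And>bs. Suc (length bs) = length as \<Longrightarrow> set bs \<subseteq> hom \<Longrightarrow> F bs = G bs"
  shows "Dif \<theta> F as = Dif \<theta> G as"
  using assms
proof (induction as arbitrary: \<theta> F G)
  case (Cons b bs)
  have "Lie \<theta> b F bs = Lie \<theta> b G bs"
    using Cons.prems by (intro Lie_cong) auto
  moreover have "Dif (\<theta> + deg b) (\<lambda>xs. F (b # xs)) bs = Dif (\<theta> + deg b) (\<lambda>xs. G (b # xs)) bs"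
    using Cons.prems by (intro Cons.IH) auto
  ultimately show ?case by simp
qed simp

lemma Br_in:
  assumes "\<And>i. i \<in> idx a b \<Longrightarrow> act (cf a b i) (f (el a b i)) \<in> S" "0 \<in> S"
    and "\<And>u v. u \<in> S \<Longrightarrow> v \<in> S \<Longrightarrow> u + v \<in> S"
  shows "Br a b f \<in> S"
proof -
  have "(\<Sum>i\<in>J. act (cf a b i) (f (el a b i))) \<in> S" if "J \<subseteq> idx a b" for J
    using that by (induction J rule: infinite_finite_induct) (auto intro: assms)
  then show ?thesis by (simp add: Br_def)
qed

text \<open>In the application \<open>S e\<close> consists of the polynomials in the first N
  variables with coefficients of degree e, and X of pairs whose polynomial uses only these
  variables. One induction then controls the variables and the degree of the values
  together.\<close>

lemma Lie_in:
  fixes S :: "bit \<Rightarrow> 'v set"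
  assumes zero: "\<And>e. 0 \<in> S e" and add: "\<And>e u v. u \<in> S e \<Longrightarrow> v \<in> S e \<Longrightarrow> u + v \<in> S e"
    and minus: "\<And>e u. u \<in> S e \<Longrightarrow> - u \<in> S e"
    and rho: "\<And>e a u. a \<in> X \<Longrightarrow> u \<in> S e \<Longrightarrow> \<rho> a u \<in> S (e + deg a)"
    and el: "\<And>a b i. a \<in> X \<Longrightarrow> b \<in> X \<Longrightarrow> el a b i \<in> X"
    and act: "\<And>a b i e u. a \<in> X \<Longrightarrow> b \<in> X \<Longrightarrow> u \<in> S e \<Longrightarrow> act (cf a b i) u \<in> S e"
    and "a \<in> X" "set as \<subseteq> X"
    and "\<And>bs. length bs = length as \<Longrightarrow> set bs \<subseteq> X \<Longrightarrow> F bs \<in> S (\<theta> + sum_list (map deg bs))"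
  shows "Lie \<theta> a F as \<in> S (\<theta> + deg a + sum_list (map deg as))"
  using assms(7-)
proof (induction as arbitrary: \<theta> F)
  case Nil
  have "F [] \<in> S (\<theta> + sum_list (map deg []))"
    by (rule Nil.prems(3)) simp_all
  then have "\<rho> a (F []) \<in> S (\<theta> + deg a)"
    using Nil.prems(1) by (intro rho) simp_all
  then have "sgn_if (\<theta> * deg a) (\<rho> a (F [])) \<in> S (\<theta> + deg a)"
    by (intro sgn_if_in minus)
  then show ?case by simp
next
  case (Cons b bs)
  have "Lie (\<theta> + deg b) a (\<lambda>xs. F (b # xs)) bs \<in> S (\<theta> + deg b + deg a + sum_list (map deg bs))"
    using Cons.prems(1,2) Cons.prems(3)[of "b # _"] by (intro Cons.IH) (auto simp: ac_simps)
  moreover have "Br a b (\<lambda>x. F (x # bs)) \<in> S (\<theta> + deg b + deg a + sum_list (map deg bs))"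
  proof (rule Br_in)
    fix i
    show "act (cf a b i) (F (el a b i # bs)) \<in> S (\<theta> + deg b + deg a + sum_list (map deg bs))"
      using Cons.prems(1,2) Cons.prems(3)[of "el a b i # bs"]
      by (intro act) (auto simp: ac_simps deg_el el)
  qed (use zero add in auto)
  ultimately have "sgn_if (deg a * deg b) (Lie (\<theta> + deg b) a (\<lambda>xs. F (b # xs)) bs) + - Br a b (\<lambda>x. F (x # bs))
      \<in> S (\<theta> + deg b + deg a + sum_list (map deg bs))"
    by (intro add sgn_if_in minus)
  then show ?case by (simp add: ac_simps)
qed

lemma Dif_in:
  fixes S :: "bit \<Rightarrow> 'v set"
  assumes zero: "\<And>e. 0 \<in> S e" and add: "\<And>e u v. u \<in> S e \<Longrightarrow> v \<in> S e \<Longrightarrow> u + v \<in> S e"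
    and minus: "\<And>e u. u \<in> S e \<Longrightarrow> - u \<in> S e"
    and rho: "\<And>e a u. a \<in> X \<Longrightarrow> u \<in> S e \<Longrightarrow> \<rho> a u \<in> S (e + deg a)"
    and el: "\<And>a b i. a \<in> X \<Longrightarrow> b \<in> X \<Longrightarrow> el a b i \<in> X"
    and act: "\<And>a b i e u. a \<in> X \<Longrightarrow> b \<in> X \<Longrightarrow> u \<in> S e \<Longrightarrow> act (cf a b i) u \<in> S e"
    and "set as \<subseteq> X"
    and "\<And>bs. Suc (length bs) = length as \<Longrightarrow> set bs \<subseteq> X \<Longrightarrow> F bs \<in> S (\<theta> + sum_list (map deg bs))"
  shows "Dif \<theta> F as \<in> S (\<theta> + sum_list (map deg as))"
  using assms(7-)
proof (induction as arbitrary: \<theta> F)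
  case Nil
  then show ?case by (simp add: zero)
next
  case (Cons b bs)
  have "Lie \<theta> b F bs \<in> S (\<theta> + deg b + sum_list (map deg bs))"
    using Cons.prems by (intro Lie_in[where X = X] assms(1-6)) auto
  moreover have "Dif (\<theta> + deg b) (\<lambda>xs. F (b # xs)) bs \<in> S (\<theta> + deg b + sum_list (map deg bs))"
    using Cons.prems(1) Cons.prems(2)[of "b # _"] by (intro Cons.IH) (auto simp: ac_simps)
  ultimately have "Lie \<theta> b F bs + - Dif (\<theta> + deg b) (\<lambda>xs. F (b # xs)) bs \<in> S (\<theta> + deg b + sum_list (map deg bs))"
    by (intro add minus)
  then show ?case by (simp add: ac_simps)
qed

text \<open>In the application \<open>\<sigma>\<close> and \<open>\<tau>\<close> are a substitution of polynomials for the variables.\<close>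

lemma Lie_natural:
  assumes \<sigma>_diff: "\<And>u v. \<sigma> (u - v) = \<sigma> u - \<sigma> v" and deg: "\<And>a. deg (\<tau> a) = deg a"
    and \<rho>: "\<And>a v. \<sigma> (\<rho> a v) = \<rho> (\<tau> a) (\<sigma> v)"
    and Br: "\<And>a b f g. (\<And>x. \<sigma> (f x) = g (\<tau> x)) \<Longrightarrow> \<sigma> (Br a b f) = Br (\<tau> a) (\<tau> b) g"
    and "\<And>bs. \<sigma> (F bs) = G (map \<tau> bs)"
  shows "\<sigma> (Lie \<theta> a F as) = Lie \<theta> (\<tau> a) G (map \<tau> as)"
proof -
  have "\<sigma> 0 = 0"
    using \<sigma>_diff[of 0 0] by simp
  then have sgn: "\<sigma> (sgn_if e v) = sgn_if e (\<sigma> v)" for e v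
    using \<sigma>_diff[of 0 v] by (simp add: sgn_if_def)
  show ?thesis
    using assms(5) by (induction as arbitrary: \<theta> F G) (auto simp: sgn \<rho> deg \<sigma>_diff intro!: arg_cong2[of _ _ _ _ minus] arg_cong[of _ _ "sgn_if _"] Br)
qed

lemma Dif_natural:
  assumes \<sigma>_diff: "\<And>u v. \<sigma> (u - v) = \<sigma> u - \<sigma> v" and deg: "\<And>a. deg (\<tau> a) = deg a"
    and \<rho>: "\<And>a v. \<sigma> (\<rho> a v) = \<rho> (\<tau> a) (\<sigma> v)"
    and Br: "\<And>a b f g. (\<And>x. \<sigma> (f x) = g (\<tau> x)) \<Longrightarrow> \<sigma> (Br a b f) = Br (\<tau> a) (\<tau> b) g"
    and "\<And>bs. \<sigma> (F bs) = G (map \<tau> bs)"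
  shows "\<sigma> (Dif \<theta> F as) = Dif \<theta> G (map \<tau> as)"
  using assms(5)
proof (induction as arbitrary: \<theta> F G)
  case Nil
  then show ?case using \<sigma>_diff[of 0 0] by simp
next
  case (Cons a as)
  have "\<sigma> (Lie \<theta> a F as) = Lie \<theta> (\<tau> a) G (map \<tau> as)"
    by (rule Lie_natural) (fact assms Cons.prems)+
  moreover have "\<sigma> (Dif (\<theta> + deg a) (\<lambda>xs. F (a # xs)) as) = Dif (\<theta> + deg a) (\<lambda>xs. G (\<tau> a # xs)) (map \<tau> as)"
    by (rule Cons.IH) (simp add: Cons.prems)
  ultimately show ?case
    by (simp add: \<sigma>_diff deg)
qed

section \<open>Skew-symmetric functions and the explicit formula\<close>

definition skew :: "('l list \<Rightarrow> 'v) \<Rightarrow> bool" where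
  "skew F \<longleftrightarrow> (\<forall>as a b bs. set as \<subseteq> hom \<longrightarrow> a \<in> hom \<longrightarrow> b \<in> hom \<longrightarrow> set bs \<subseteq> hom \<longrightarrow>
     F (as @ a # b # bs) = - sgn_if (deg a * deg b) (F (as @ b # a # bs)))"

lemma skewD:
  "skew F \<Longrightarrow> set as \<subseteq> hom \<Longrightarrow> a \<in> hom \<Longrightarrow> b \<in> hom \<Longrightarrow> set bs \<subseteq> hom \<Longrightarrow>
     F (as @ a # b # bs) = - sgn_if (deg a * deg b) (F (as @ b # a # bs))"
  unfolding skew_def by blast

lemma skew_Cons:
  assumes "skew F" "a \<in> hom" shows "skew (\<lambda>xs. F (a # xs))"
  unfolding skew_def
proof (intro allI impI)
  fix as x y bs
  assume "set as \<subseteq> hom" "x \<in> hom" "y \<in> hom" "set bs \<subseteq> hom"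
  then show "F (a # as @ x # y # bs) = - sgn_if (deg x * deg y) (F (a # as @ y # x # bs))"
    using assms skewD[of F "a # as" x y bs] by auto
qed

lemma skew_head:
  "skew F \<Longrightarrow> a \<in> hom \<Longrightarrow> b \<in> hom \<Longrightarrow> set bs \<subseteq> hom \<Longrightarrow>
     F (a # b # bs) = - sgn_if (deg a * deg b) (F (b # a # bs))"
  using skewD[of F "[]" a b bs] by auto

lemma Br_skew_head:
  assumes "skew F" "a \<in> hom" "b \<in> hom" "c \<in> hom" "set bs \<subseteq> hom"
  shows "Br a b (\<lambda>x. F (x # c # bs)) = - sgn_if ((deg a + deg b) * deg c) (Br a b (\<lambda>x. F (c # x # bs)))"
proof -
  have "Br a b (\<lambda>x. F (x # c # bs)) = Br a b (\<lambda>x. - sgn_if ((deg a + deg b) * deg c) (F (c # x # bs)))"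
  proof (rule Br_cong)
    fix x assume "deg x = deg a + deg b" "a \<in> hom \<Longrightarrow> b \<in> hom \<Longrightarrow> x \<in> hom"
    then show "F (x # c # bs) = - sgn_if ((deg a + deg b) * deg c) (F (c # x # bs))"
      using assms skew_head[of F x c bs] by simp
  qed
  then show ?thesis by (simp add: Br_uminus Br_sgn)
qed

text \<open>Only the exchange of the first two arguments needs work: the terms with [c, a] and
  [c, b] trade places, after each bracket has been moved past the other argument. No symmetry of the
  bracket itself enters.\<close>

lemma Lie_skew:
  assumes "skew F" "c \<in> hom" shows "skew (Lie \<theta> c F)"
proof -
  have "Lie \<theta> c F (as @ a # b # bs) = - sgn_if (deg a * deg b) (Lie \<theta> c F (as @ b # a # bs))"
    if "set as \<subseteq> hom" "a \<in> hom" "b \<in> hom" "set bs \<subseteq> hom" for as a b bs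
    using assms that
  proof (induction as arbitrary: \<theta> F)
    case Nil
    have eq: "Br c a (\<lambda>x. F (x # b # bs)) = - sgn_if ((deg c + deg a) * deg b) (Br c a (\<lambda>x. F (b # x # bs)))"
      "Br c b (\<lambda>x. F (x # a # bs)) = - sgn_if ((deg c + deg b) * deg a) (Br c b (\<lambda>x. F (a # x # bs)))"
      using Nil by (intro Br_skew_head; simp)+
    have "Lie (\<theta> + deg a + deg b) c (\<lambda>xs. F (a # b # xs)) bs
        = Lie (\<theta> + deg a + deg b) c (\<lambda>xs. - sgn_if (deg a * deg b) (F (b # a # xs))) bs"
      using Nil by (intro Lie_cong) (auto intro!: skew_head)
    then show ?case
      by (simp add: eq Br_uminus Br_sgn Lie_uminus Lie_sgn sgn_if_simps algebra_simps)
  next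
    case (Cons x xs)
    have "Br c x (\<lambda>y. F (y # xs @ a # b # bs)) =
        Br c x (\<lambda>y. - sgn_if (deg a * deg b) (F (y # xs @ b # a # bs)))"
    proof (rule Br_cong)
      fix y assume "c \<in> hom \<Longrightarrow> x \<in> hom \<Longrightarrow> y \<in> hom"
      then show "F (y # xs @ a # b # bs) = - sgn_if (deg a * deg b) (F (y # xs @ b # a # bs))"
        using Cons.prems skewD[of F "y # xs" a b bs] by simp
    qed
    moreover have "Lie (\<theta> + deg x) c (\<lambda>ys. F (x # ys)) (xs @ a # b # bs)
        = - sgn_if (deg a * deg b) (Lie (\<theta> + deg x) c (\<lambda>ys. F (x # ys)) (xs @ b # a # bs))"
      using Cons.prems by (intro Cons.IH skew_Cons) auto
    ultimately show ?case
      by (simp add: Br_uminus Br_sgn sgn_if_simps algebra_simps)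
  qed
  then show ?thesis unfolding skew_def by blast
qed

text \<open>The recursion leaves the bracket of a with the j-th argument in position j.
  Skew-symmetry brings it to the front, at the cost of \<open>(-1)^j\<close> and a degree sign for
  each argument passed. The part of that sign due to a cancels the sign \<open>deg a * deg b\<close>
  of the recursion, so only degrees of the arguments remain.\<close>

lemma Lie_formula:
  assumes "skew F" "a \<in> hom" "set as \<subseteq> hom"
  shows "Lie \<theta> a F as = sgn_if (\<theta> * deg a) (\<rho> a (F as)) -
    (\<Sum>j<length as. sgn_if (of_nat j + sum_list (take j (map deg as)) * deg (as ! j))
       (Br a (as ! j) (\<lambda>x. F (x # omit j as))))"
  using assms
proof (induction as arbitrary: \<theta> F)
  case Nil
  then show ?case by simp
next
  case (Cons b bs)
  have swap: "Br a (bs ! j) (\<lambda>x. F (x # b # omit j bs)) =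
      - sgn_if ((deg a + deg (bs ! j)) * deg b) (Br a (bs ! j) (\<lambda>x. F (b # x # omit j bs)))"
    if "j < length bs" for j
    using Cons.prems that
    by (intro Br_skew_head) (auto dest: subsetD[OF set_omit])
  have "Lie (\<theta> + deg b) a (\<lambda>xs. F (b # xs)) bs = sgn_if ((\<theta> + deg b) * deg a) (\<rho> a (F (b # bs))) -
    (\<Sum>j<length bs. sgn_if (of_nat j + sum_list (take j (map deg bs)) * deg (bs ! j))
       (Br a (bs ! j) (\<lambda>x. F (b # x # omit j bs))))"
    using Cons.prems by (intro Cons.IH skew_Cons) auto
  also have "(\<Sum>j<length bs. sgn_if (of_nat j + sum_list (take j (map deg bs)) * deg (bs ! j))
       (Br a (bs ! j) (\<lambda>x. F (b # x # omit j bs)))) =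
    sgn_if (deg a * deg b) (\<Sum>j<length bs. sgn_if (of_nat (Suc j) + sum_list (take (Suc j) (map deg (b # bs))) * deg ((b # bs) ! Suc j))
       (Br a ((b # bs) ! Suc j) (\<lambda>x. F (x # omit (Suc j) (b # bs)))))"
    unfolding sgn_if_sum
    by (intro sum.cong refl) (simp add: swap sgn_if_uminus algebra_simps sgn_if_Suc)
  finally have IH: "Lie (\<theta> + deg b) a (\<lambda>xs. F (b # xs)) bs = sgn_if ((\<theta> + deg b) * deg a) (\<rho> a (F (b # bs))) -
    sgn_if (deg a * deg b) (\<Sum>j<length bs. sgn_if (of_nat (Suc j) + sum_list (take (Suc j) (map deg (b # bs))) * deg ((b # bs) ! Suc j))
       (Br a ((b # bs) ! Suc j) (\<lambda>x. F (x # omit (Suc j) (b # bs)))))" .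
  show ?case
    unfolding Lie.simps IH list.size(4) add_Suc_right add_0_right sum.lessThan_Suc_shift
    by (simp add: sgn_if_simps algebra_simps)
qed

text \<open>The terms that involve the first argument come from \<open>Lie_formula\<close>, all
  others from the induction hypothesis with shifted indices. In the sum over single arguments the
  shift changes the parity of i, which is the minus sign in the recursion.\<close>

lemma Dif_formula:
  assumes "skew F" "set as \<subseteq> hom" and es: "es = map deg as"
  shows "Dif \<theta> F as =
     (\<Sum>i<length as. sgn_if (of_nat i + (\<theta> + sum_list (take i es)) * es ! i) (\<rho> (as ! i) (F (omit i as)))) +
     (\<Sum>j<length as. \<Sum>i<j. sgn_if (of_nat (i + j) + sum_list (take i es) * es ! i +
          sum_list (take j es) * es ! j + es ! i * es ! j)
         (Br (as ! i) (as ! j) (\<lambda>x. F (x # omit i (omit j as)))))"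
  using assms
proof (induction as arbitrary: \<theta> F es)
  case Nil
  then show ?case by simp
next
  case (Cons b bs)
  define E where "E = map deg bs"
  have es: "es = deg b # E" using Cons.prems by (simp add: E_def)
  have hom: "i < length bs \<Longrightarrow> bs ! i \<in> hom" for i
    using Cons.prems by auto
  have En: "i < length bs \<Longrightarrow> E ! i = deg (bs ! i)" for i
    by (simp add: E_def)
  have swap: "Br (bs ! i) (bs ! j) (\<lambda>x. F (x # b # omit i (omit j bs))) =
      - sgn_if ((E ! i + E ! j) * deg b) (Br (bs ! i) (bs ! j) (\<lambda>x. F (b # x # omit i (omit j bs))))"
    if "i < j" "j < length bs" for i j
  proof -
    have "set (omit i (omit j bs)) \<subseteq> hom"
      using Cons.prems set_omit[of i "omit j bs"] set_omit[of j bs] by auto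
    then show ?thesis
      using Cons.prems that Br_skew_head[of F "bs ! i" "bs ! j" b "omit i (omit j bs)"] by (simp add: En hom)
  qed
  have IH: "Dif (\<theta> + deg b) (\<lambda>xs. F (b # xs)) bs =
     (\<Sum>i<length bs. sgn_if (of_nat i + (\<theta> + deg b + sum_list (take i E)) * E ! i) (\<rho> (bs ! i) (F (b # omit i bs)))) +
     (\<Sum>j<length bs. \<Sum>i<j. sgn_if (of_nat (i + j) + sum_list (take i E) * E ! i +
          sum_list (take j E) * E ! j + E ! i * E ! j)
         (Br (bs ! i) (bs ! j) (\<lambda>x. F (b # x # omit i (omit j bs)))))"
    using Cons.prems by (intro Cons.IH skew_Cons) (auto simp: E_def)
  have L: "Lie \<theta> b F bs = sgn_if (\<theta> * deg b) (\<rho> b (F bs)) -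
    (\<Sum>j<length bs. sgn_if (of_nat j + sum_list (take j E) * E ! j)
       (Br b (bs ! j) (\<lambda>x. F (x # omit j bs))))"
    using Lie_formula[of F b bs \<theta>] Cons.prems by (simp add: E_def)
  have S1: "(\<Sum>i<length (b # bs). sgn_if (of_nat i + (\<theta> + sum_list (take i es)) * es ! i) (\<rho> ((b # bs) ! i) (F (omit i (b # bs))))) =
     sgn_if (\<theta> * deg b) (\<rho> b (F bs)) -
     (\<Sum>i<length bs. sgn_if (of_nat i + (\<theta> + deg b + sum_list (take i E)) * E ! i) (\<rho> (bs ! i) (F (b # omit i bs))))"
    by (simp del: sum.lessThan_Suc add: sum.lessThan_Suc_shift es add.assoc sgn_if_Suc sum_negf)
  \<comment> \<open>Here both indices shift, so the parity of \<open>i + j\<close> is unchanged; the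
    minus sign comes instead from moving the bracket past b with \<open>swap\<close>.\<close>
  have S2: "(\<Sum>j<length (b # bs). \<Sum>i<j. sgn_if (of_nat (i + j) + sum_list (take i es) * es ! i +
          sum_list (take j es) * es ! j + es ! i * es ! j)
         (Br ((b # bs) ! i) ((b # bs) ! j) (\<lambda>x. F (x # omit i (omit j (b # bs)))))) =
     (\<Sum>j<length bs. - sgn_if (of_nat j + sum_list (take j E) * E ! j) (Br b (bs ! j) (\<lambda>x. F (x # omit j bs))) +
        (\<Sum>i<j. - sgn_if (of_nat (i + j) + sum_list (take i E) * E ! i + sum_list (take j E) * E ! j + E ! i * E ! j)
         (Br (bs ! i) (bs ! j) (\<lambda>x. F (b # x # omit i (omit j bs))))))"
    by (simp del: sum.lessThan_Suc add: sum.lessThan_Suc_shift es, intro sum.cong refl arg_cong2[of _ _ _ _ "(+)"])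
       (simp_all add: swap sgn_if_uminus algebra_simps sgn_if_Suc)
  show ?case
    unfolding S1 S2 Dif.simps IH L sum.distrib sum_negf by simp
qed

end

text \<open>\<open>lin\<close> stands for the functions under which the formal bracket behaves like
  a Lie bracket. The substitution of -\<partial> - \<lambda> in C2, for instance, becomes symmetric
  only under a function that turns \<partial> into a scalar. The closure conditions keep all
  functions built by the recursions inside \<open>lin\<close>. In \<open>lin_sgn\<close> the sign
  may depend on the degree, since in the application linearity is tested with the degree tag
  fixed.\<close>

locale super_cartan = super_cartan_ops deg hom idx cf el act \<rho>
  for deg :: "'l \<Rightarrow> bit" and hom :: "'l set"
    and idx :: "'l \<Rightarrow> 'l \<Rightarrow> nat set" and cf :: "'l \<Rightarrow> 'l \<Rightarrow> nat \<Rightarrow> 's"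
    and el :: "'l \<Rightarrow> 'l \<Rightarrow> nat \<Rightarrow> 'l"
    and act :: "'s \<Rightarrow> 'v::ab_group_add \<Rightarrow> 'v" and \<rho> :: "'l \<Rightarrow> 'v \<Rightarrow> 'v" +
  fixes lin :: "('l \<Rightarrow> 'v) \<Rightarrow> bool"
  assumes lin_diff: "lin f \<Longrightarrow> lin g \<Longrightarrow> lin (\<lambda>x. f x - g x)"
    and lin_sgn: "lin f \<Longrightarrow> lin (\<lambda>x. sgn_if (\<phi> (deg x)) (f x))"
    and lin_rep: "lin f \<Longrightarrow> lin (\<lambda>x. \<rho> a (f x))"
    and lin_act: "lin f \<Longrightarrow> lin (\<lambda>x. act k (f x))"
    and lin_\<rho>: "lin (\<lambda>a. \<rho> a v)"
    and lin_Br_left: "lin f \<Longrightarrow> lin (\<lambda>a. Br a b f)"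
    and lin_Br_right: "lin f \<Longrightarrow> lin (\<lambda>b. Br a b f)"
    and rep: "a \<in> hom \<Longrightarrow> b \<in> hom \<Longrightarrow>
      \<rho> a (\<rho> b v) - sgn_if (deg a * deg b) (\<rho> b (\<rho> a v)) = Br a b (\<lambda>x. \<rho> x v)"
    and jacobi: "a \<in> hom \<Longrightarrow> b \<in> hom \<Longrightarrow> c \<in> hom \<Longrightarrow> lin f \<Longrightarrow>
      Br b c (\<lambda>x. Br a x f) =
      Br a b (\<lambda>x. Br x c f) + sgn_if (deg a * deg b) (Br a c (\<lambda>x. Br b x f))"
    and Br_skew: "a \<in> hom \<Longrightarrow> b \<in> hom \<Longrightarrow> lin f \<Longrightarrow>
      Br a b f = - sgn_if (deg a * deg b) (Br b a f)"
begin

section \<open>Multilinear functions and the Cartan relations\<close>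

definition multilin :: "('l list \<Rightarrow> 'v) \<Rightarrow> bool" where
  "multilin F \<longleftrightarrow> (\<forall>as bs. lin (\<lambda>x. F (as @ x # bs)))"

lemma multilinD: "multilin F \<Longrightarrow> lin (\<lambda>x. F (as @ x # bs))"
  unfolding multilin_def by blast

lemma multilin_Cons: "multilin F \<Longrightarrow> multilin (\<lambda>xs. F (a # xs))"
  using multilinD[of F "a # _"] by (simp add: multilin_def)

lemma multilin_head: "multilin F \<Longrightarrow> lin (\<lambda>x. F (x # as))"
  using multilinD[of F "[]"] by simp

lemma lin_zero: "lin f \<Longrightarrow> lin (\<lambda>x. 0)"
  using lin_diff[of f f] by simp

lemma lin_Br:
  assumes "\<And>x. lin (f x)" shows "lin (\<lambda>y. Br a b (\<lambda>x. f x y))"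
proof -
  have "lin (\<lambda>y. \<Sum>i\<in>J. act (cf a b i) (f (el a b i) y))" for J
  proof (induction J rule: infinite_finite_induct)
    case (insert i J)
    \<comment> \<open>\<open>lin\<close> is closed under differences, so the sum u + v is written as
      u - (0 - v).\<close>
    then have "lin (\<lambda>y. act (cf a b i) (f (el a b i) y) - (0 - (\<Sum>i\<in>J. act (cf a b i) (f (el a b i) y))))"
      by (intro lin_diff lin_act assms lin_zero[OF assms])
    then show ?case using insert by simp
  qed (simp_all add: lin_zero[OF assms])
  then show ?thesis by (simp add: Br_def)
qed

text \<open>For an inserted argument x, which enters through F and also through the degree
  \<open>\<theta> + deg x\<close>. A general \<open>\<phi>\<close> is needed because the recursion
  changes the degree further.\<close>

lemma lin_Lie_param:
  assumes "\<And>xs. lin (\<lambda>x. F x xs)" shows "lin (\<lambda>x. Lie (\<phi> (deg x)) a (F x) as)"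
  using assms
proof (induction as arbitrary: F \<phi>)
  case Nil
  then show ?case
    using lin_sgn[OF lin_rep[OF Nil.prems[of "[]"]], of "\<lambda>e. \<phi> e * deg a" a] by simp
next
  case (Cons b bs)
  have "lin (\<lambda>x. sgn_if (deg a * deg b) (Lie (\<phi> (deg x) + deg b) a (\<lambda>xs. F x (b # xs)) bs) -
     Br a b (\<lambda>y. F x (y # bs)))"
    by (intro lin_diff lin_Br Cons.prems lin_sgn[where \<phi> = "\<lambda>_. _"] Cons.IH[where \<phi> = "\<lambda>e. \<phi> e + deg b"])
  then show ?case by simp
qed

lemma lin_Dif_param:
  assumes "\<And>xs. lin (\<lambda>x. F x xs)" shows "lin (\<lambda>x. Dif (\<phi> (deg x)) (F x) as)"
  using assms
proof (induction as arbitrary: F \<phi>)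
  case Nil
  then show ?case by (auto intro: lin_zero)
next
  case (Cons b bs)
  have "lin (\<lambda>x. Lie (\<phi> (deg x)) b (F x) bs - Dif (\<phi> (deg x) + deg b) (\<lambda>xs. F x (b # xs)) bs)"
    by (intro lin_diff lin_Lie_param Cons.prems Cons.IH[where \<phi> = "\<lambda>e. \<phi> e + deg b"])
  then show ?case by simp
qed

lemma lin_Lie_arg:
  assumes "multilin F" shows "lin (\<lambda>a. Lie \<theta> a F as)"
  using assms
proof (induction as arbitrary: \<theta> F)
  case Nil
  then show ?case
    using lin_sgn[OF lin_\<rho>, of "\<lambda>e. \<theta> * e"] by simp
next
  case (Cons b bs)
  have "lin (\<lambda>a. sgn_if (deg a * deg b) (Lie (\<theta> + deg b) a (\<lambda>xs. F (b # xs)) bs) - Br a b (\<lambda>x. F (x # bs)))"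
    by (intro lin_diff lin_Br_left lin_sgn[where \<phi> = "\<lambda>e. e * deg b"] Cons.IH multilin_Cons multilin_head Cons.prems)
  then show ?case by simp
qed

lemma Lie_multilin:
  assumes "multilin F" shows "multilin (Lie \<theta> a F)"
proof -
  have "lin (\<lambda>x. Lie \<theta> a F (as @ x # bs))" for as bs
    using assms
  proof (induction as arbitrary: \<theta> F)
    case Nil
    have "lin (\<lambda>x. sgn_if (deg a * deg x) (Lie (\<theta> + deg x) a (\<lambda>xs. F (x # xs)) bs) - Br a x (\<lambda>x. F (x # bs)))"
      by (intro lin_diff lin_Br_right lin_sgn[where \<phi> = "\<lambda>e. deg a * e"]
          lin_Lie_param[where \<phi> = "\<lambda>e. \<theta> + e"] multilin_head Nil)
    then show ?case by simp
  next
    case (Cons b cs)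
    have "lin (\<lambda>x. F ((y # cs) @ x # bs))" for y
      using Cons.prems unfolding multilin_def by blast
    then have "lin (\<lambda>x. sgn_if (deg a * deg b) (Lie (\<theta> + deg b) a (\<lambda>xs. F (b # xs)) (cs @ x # bs))
       - Br a b (\<lambda>y. F (y # cs @ x # bs)))"
      by (intro lin_diff lin_Br lin_sgn[where \<phi> = "\<lambda>_. _"] Cons.IH multilin_Cons Cons.prems) simp
    then show ?case by simp
  qed
  then show ?thesis unfolding multilin_def by blast
qed

lemma Dif_multilin:
  assumes "multilin F" shows "multilin (Dif \<theta> F)"
proof -
  have "lin (\<lambda>x. Dif \<theta> F (as @ x # bs))" for as bs
    using assms
  proof (induction as arbitrary: \<theta> F)
    case Nil
    have "lin (\<lambda>x. Lie \<theta> x F bs - Dif (\<theta> + deg x) (\<lambda>xs. F (x # xs)) bs)"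
      by (intro lin_diff lin_Lie_arg lin_Dif_param[where \<phi> = "\<lambda>e. \<theta> + e"] multilin_head Nil)
    then show ?case by simp
  next
    case (Cons b cs)
    have "lin (\<lambda>x. Lie \<theta> b F (cs @ x # bs))"
      using Lie_multilin[OF Cons.prems] unfolding multilin_def by blast
    then have "lin (\<lambda>x. Lie \<theta> b F (cs @ x # bs) - Dif (\<theta> + deg b) (\<lambda>xs. F (b # xs)) (cs @ x # bs))"
      by (intro lin_diff Cons.IH multilin_Cons Cons.prems)
    then show ?case by simp
  qed
  then show ?thesis unfolding multilin_def by blast
qed

text \<open>At the first two arguments a, b the value consists of two Lie derivatives, which
  exchange under the swap, of the term with [a, b], which is governed by \<open>Br_skew\<close>, and
  of the differential of F with both inserted, where skew-symmetry of F applies.\<close>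

lemma Dif_skew:
  assumes "skew F" "multilin F" shows "skew (Dif \<theta> F)"
proof -
  have "Dif \<theta> F (as @ a # b # bs) = - sgn_if (deg a * deg b) (Dif \<theta> F (as @ b # a # bs))"
    if "set as \<subseteq> hom" "a \<in> hom" "b \<in> hom" "set bs \<subseteq> hom" for as a b bs
    using assms that
  proof (induction as arbitrary: \<theta> F)
    case Nil
    have 1: "Br a b (\<lambda>x. F (x # bs)) = - sgn_if (deg a * deg b) (Br b a (\<lambda>x. F (x # bs)))"
      using Nil by (intro Br_skew multilin_head)
    have 2: "Dif (\<theta> + (deg a + deg b)) (\<lambda>xs. F (a # b # xs)) bs
        = Dif (\<theta> + (deg a + deg b)) (\<lambda>xs. - sgn_if (deg a * deg b) (F (b # a # xs))) bs"
      using Nil by (intro Dif_cong) (auto intro!: skew_head)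
    show ?case
      by (simp add: 1 2 Br_uminus Br_sgn Dif_uminus Dif_sgn sgn_if_simps algebra_simps)
  next
    case (Cons x xs)
    have "Lie \<theta> x F (xs @ a # b # bs) = - sgn_if (deg a * deg b) (Lie \<theta> x F (xs @ b # a # bs))"
      using Cons.prems Lie_skew[of F x \<theta>] by (intro skewD) auto
    moreover have "Dif (\<theta> + deg x) (\<lambda>ys. F (x # ys)) (xs @ a # b # bs)
        = - sgn_if (deg a * deg b) (Dif (\<theta> + deg x) (\<lambda>ys. F (x # ys)) (xs @ b # a # bs))"
      using Cons.prems by (intro Cons.IH skew_Cons multilin_Cons) auto
    ultimately show ?case
      by (simp add: sgn_if_simps algebra_simps)
  qed
  then show ?thesis unfolding skew_def by blast
qed

text \<open>The sign stands at the first term rather than the second because each \<open>Lie\<close>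
  already contains the sign of moving its element past the function, and the outer one also moves
  past the element inserted by the inner one. The base case is the representation property, the step
  the Jacobi identity.\<close>

lemma Lie_commutator:
  assumes "multilin F" "a \<in> hom" "b \<in> hom" "set cs \<subseteq> hom"
  shows "sgn_if (deg a * deg b) (Lie (\<theta> + deg b) a (Lie \<theta> b F) cs) - Lie (\<theta> + deg a) b (Lie \<theta> a F) cs
    = Br a b (\<lambda>x. Lie \<theta> x F cs)"
  using assms
proof (induction cs arbitrary: \<theta> F)
  case Nil
  have "Br a b (\<lambda>x. Lie \<theta> x F []) = Br a b (\<lambda>x. sgn_if (\<theta> * (deg a + deg b)) (\<rho> x (F [])))"
    by (rule Br_cong) simp
  also have "\<dots> = sgn_if (\<theta> * (deg a + deg b)) (\<rho> a (\<rho> b (F [])) - sgn_if (deg a * deg b) (\<rho> b (\<rho> a (F []))))"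
    using Nil by (simp add: Br_sgn rep)
  finally show ?case
    by (simp add: \<rho>_sgn sgn_if_simps algebra_simps)
next
  case (Cons c cs)
  let ?a = "deg a" and ?b = "deg b" and ?c = "deg c"
  \<comment> \<open>At the first argument c, either both derivatives pass c, or one of them forms a
    bracket with c, or both do. The two mixed terms cancel in the commutator; the first term is
    covered by induction and the last by \<open>J\<close>.\<close>
  have LL: "Lie (\<theta> + deg y) x (Lie \<theta> y F) (c # cs) =
      sgn_if (deg x * ?c + deg y * ?c) (Lie (\<theta> + ?c + deg y) x (Lie (\<theta> + ?c) y (\<lambda>xs. F (c # xs))) cs)
      - sgn_if (deg x * ?c) (Br y c (\<lambda>z. Lie (\<theta> + deg y + ?c) x (\<lambda>xs. F (z # xs)) cs))
      - sgn_if (deg y * (deg x + ?c)) (Br x c (\<lambda>z. Lie (\<theta> + deg x + ?c) y (\<lambda>xs. F (z # xs)) cs))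
      + Br x c (\<lambda>z. Br y z (\<lambda>w. F (w # cs)))" for x y
  proof -
    have "Br x c (\<lambda>z. Lie \<theta> y F (z # cs)) =
       Br x c (\<lambda>z. sgn_if (deg y * (deg x + ?c)) (Lie (\<theta> + deg x + ?c) y (\<lambda>xs. F (z # xs)) cs)
         - Br y z (\<lambda>w. F (w # cs)))"
      by (rule Br_cong) (simp add: add.assoc)
    then show ?thesis
      by (simp add: Lie_diff Lie_sgn Lie_Br Br_diff Br_sgn sgn_if_simps ac_simps)
  qed
  have J: "Br b c (\<lambda>x. Br a x (\<lambda>w. F (w # cs))) =
      Br a b (\<lambda>x. Br x c (\<lambda>w. F (w # cs))) + sgn_if (?a * ?b) (Br a c (\<lambda>x. Br b x (\<lambda>w. F (w # cs))))"
    using Cons.prems by (intro jacobi multilin_head) auto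
  have IH: "sgn_if (?a * ?b) (Lie (\<theta> + ?c + ?b) a (Lie (\<theta> + ?c) b (\<lambda>xs. F (c # xs))) cs)
      - Lie (\<theta> + ?c + ?a) b (Lie (\<theta> + ?c) a (\<lambda>xs. F (c # xs))) cs
      = Br a b (\<lambda>x. Lie (\<theta> + ?c) x (\<lambda>xs. F (c # xs)) cs)"
    using Cons.prems by (intro Cons.IH multilin_Cons) auto
  have "Br a b (\<lambda>x. Lie \<theta> x F (c # cs)) =
     Br a b (\<lambda>x. sgn_if ((?a + ?b) * ?c) (Lie (\<theta> + ?c) x (\<lambda>xs. F (c # xs)) cs) - Br x c (\<lambda>w. F (w # cs)))"
    by (rule Br_cong) simp
  also have "\<dots> = sgn_if ((?a + ?b) * ?c) (Br a b (\<lambda>x. Lie (\<theta> + ?c) x (\<lambda>xs. F (c # xs)) cs))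
      - Br a b (\<lambda>x. Br x c (\<lambda>w. F (w # cs)))"
    by (simp add: Br_diff Br_sgn)
  finally show ?case
    unfolding LL IH[symmetric] using J by (simp add: sgn_if_simps algebra_simps)
qed

text \<open>At a first argument b the terms that still contain a differential agree by induction;
  what is left is the commutator of the derivatives along a and b. The differential is even, so no
  sign appears.\<close>

lemma Lie_Dif:
  assumes "multilin F" "a \<in> hom" "set cs \<subseteq> hom"
  shows "Lie \<theta> a (Dif \<theta> F) cs = Dif (\<theta> + deg a) (Lie \<theta> a F) cs"
  using assms
proof (induction cs arbitrary: \<theta> F)
  case Nil
  then show ?case by (simp add: \<rho>_simps)
next
  case (Cons b cs)
  let ?a = "deg a" and ?b = "deg b"
  have IH: "Lie (\<theta> + ?b) a (Dif (\<theta> + ?b) (\<lambda>xs. F (b # xs))) cs =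
      Dif (\<theta> + ?b + ?a) (Lie (\<theta> + ?b) a (\<lambda>xs. F (b # xs))) cs"
    using Cons.prems by (intro Cons.IH multilin_Cons) auto
  have "Br a b (\<lambda>x. Dif \<theta> F (x # cs)) =
      Br a b (\<lambda>x. Lie \<theta> x F cs - Dif (\<theta> + ?a + ?b) (\<lambda>xs. F (x # xs)) cs)"
    by (rule Br_cong) (simp add: add.assoc)
  moreover have "sgn_if (?a * ?b) (Lie (\<theta> + ?b) a (Lie \<theta> b F) cs) - Lie (\<theta> + ?a) b (Lie \<theta> a F) cs
    = Br a b (\<lambda>x. Lie \<theta> x F cs)"
    using Cons.prems by (intro Lie_commutator) auto
  ultimately show ?case
    by (simp add: IH Lie_diff Dif_diff Dif_sgn Dif_Br Br_diff sgn_if_simps algebra_simps)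
qed

text \<open>Inserting a gives \<open>L_a d - d (L_a - d i_a)\<close>, where \<open>i_a\<close> is
  the insertion. The first two terms cancel by \<open>Lie_Dif\<close>, and the last is the induction
  hypothesis for the inserted function.\<close>

lemma Dif_Dif:
  assumes "multilin F" "set cs \<subseteq> hom" shows "Dif \<theta> (Dif \<theta> F) cs = 0"
  using assms
proof (induction cs arbitrary: \<theta> F)
  case (Cons a cs)
  have "Dif (\<theta> + deg a) (Dif (\<theta> + deg a) (\<lambda>xs. F (a # xs))) cs = 0"
    using Cons.prems by (intro Cons.IH multilin_Cons) auto
  moreover have "Lie \<theta> a (Dif \<theta> F) cs = Dif (\<theta> + deg a) (Lie \<theta> a F) cs"
    using Cons.prems by (intro Lie_Dif) auto
  ultimately show ?case by (simp add: Dif_diff)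
qed simp

end

section \<open>Polynomials with coefficients in a module\<close>

lemma poly_mapping_sum_single:
  "P = (\<Sum>k\<in>Poly_Mapping.keys P. Poly_Mapping.single k (Poly_Mapping.lookup P k))"
  by (rule poly_mapping_eqI)
    (auto simp: lookup_sum lookup_single when_def not_in_keys_iff_lookup_eq_zero sum.delta)

lemma additive_eqI:
  assumes "additive f" "additive g"
    and "\<And>k x. f (Poly_Mapping.single k x) = g (Poly_Mapping.single k x)"
  shows "f P = g P"
proof -
  have "f P = (\<Sum>k\<in>Poly_Mapping.keys P. f (Poly_Mapping.single k (Poly_Mapping.lookup P k)))"
    by (subst (1) poly_mapping_sum_single) (rule additive.sum[OF assms(1)])
  also have "\<dots> = g P"
    by (subst (2) poly_mapping_sum_single) (simp add: assms(3) additive.sum[OF assms(2)])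
  finally show ?thesis .
qed

text \<open>The range of summation depends on P; keys that cancel in a sum contribute nothing
  because an additive \<open>\<Phi> k\<close> vanishes at 0.\<close>

lemma additive_keys_sum:
  assumes "\<And>k. additive (\<Phi> k)"
  shows "additive (\<lambda>P. \<Sum>k\<in>Poly_Mapping.keys P. \<Phi> k (Poly_Mapping.lookup P k))"
  unfolding additive_def
  by (intro allI setsum_keys_plus_distrib additive.zero additive.add assms)

lemma keys_sum_single:
  assumes "additive (\<Phi> k)"
  shows "(\<Sum>l\<in>Poly_Mapping.keys (Poly_Mapping.single k x). \<Phi> l (Poly_Mapping.lookup (Poly_Mapping.single k x) l)) = \<Phi> k x"
  using additive.zero[OF assms] by simp

lemma additive_comp: "additive f \<Longrightarrow> additive g \<Longrightarrow> additive (\<lambda>x. f (g x))"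
  by (simp add: additive_def)

lemma additive_apply_sgn_if: "additive f \<Longrightarrow> f (sgn_if e x) = sgn_if e (f x)"
  by (simp add: sgn_if_def additive.minus)

lemma additive_sum: "(\<And>i. i \<in> I \<Longrightarrow> additive (f i)) \<Longrightarrow> additive (\<lambda>x. \<Sum>i\<in>I. f i x)"
  for f :: "'i \<Rightarrow> 'x::ab_group_add \<Rightarrow> 'y::ab_group_add"
  by (simp add: additive_def sum.distrib)

lemma additive_cst: "additive cst"
  by (simp add: additive_def cst_def single_add)

lemma cst_add: "cst (x + y) = cst x + cst y"
  by (simp add: cst_def single_add)

lemma cst_zero [simp]: "cst 0 = 0"
  by (simp add: cst_def)

section \<open>Substitution into scalar polynomials\<close>

definition mev :: "(nat \<Rightarrow> complex mpoly) \<Rightarrow> (nat \<Rightarrow>\<^sub>0 nat) \<Rightarrow> complex mpoly" where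
  "mev s k = (\<Prod>v \<in> Poly_Mapping.keys k. s v ^ Poly_Mapping.lookup k v)"

lemma mev_superset:
  assumes "finite A" "Poly_Mapping.keys k \<subseteq> A"
  shows "mev s k = (\<Prod>v \<in> A. s v ^ Poly_Mapping.lookup k v)"
  unfolding mev_def by (rule prod.mono_neutral_left) (auto simp: assms in_keys_iff)

lemma mev_zero [simp]: "mev s 0 = 1"
  by (simp add: mev_def)

lemma mev_add: "mev s (k + l) = mev s k * mev s l"
proof -
  let ?A = "Poly_Mapping.keys k \<union> Poly_Mapping.keys l"
  have "mev s (k + l) = (\<Prod>v \<in> ?A. s v ^ Poly_Mapping.lookup (k + l) v)"
    by (rule mev_superset) (auto dest: subsetD[OF Poly_Mapping.keys_add])
  moreover have "mev s k = (\<Prod>v \<in> ?A. s v ^ Poly_Mapping.lookup k v)"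
    by (rule mev_superset) auto
  moreover have "mev s l = (\<Prod>v \<in> ?A. s v ^ Poly_Mapping.lookup l v)"
    by (rule mev_superset) auto
  ultimately show ?thesis
    by (simp add: lookup_add power_add prod.distrib)
qed

lemma mev_single: "mev s (Poly_Mapping.single i n) = s i ^ n"
  by (cases "n = 0") (simp_all add: mev_def)

lemma mon_zero: "mon 0 = 1"
  by (simp add: mon_def)

lemma mon_add: "mon (k + l) = mon k * mon l"
  by (simp add: mon_def mult_single)

lemma var_power: "var i ^ n = mon (Poly_Mapping.single i n)"
  by (induction n) (simp_all add: mon_zero var_def flip: mon_add single_add)

lemma mon_sum: "finite A \<Longrightarrow> mon (\<Sum>i\<in>A. f i) = (\<Prod>i\<in>A. mon (f i))"
  by (induction A rule: finite_induct) (simp_all add: mon_zero mon_add)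

lemma mev_var: "mev var k = mon k"
  unfolding mev_def var_power
  by (simp flip: mon_sum poly_mapping_sum_single)

text \<open>The scalar counterpart of \<open>msubst\<close>, written with the ring product: a ring
  endomorphism over which \<open>msubst\<close> is semilinear.\<close>

definition csub :: "(nat \<Rightarrow> complex mpoly) \<Rightarrow> complex mpoly \<Rightarrow> complex mpoly" where
  "csub s Q = (\<Sum>k \<in> Poly_Mapping.keys Q. cst (Poly_Mapping.lookup Q k) * mev s k)"

lemma additive_csub: "additive (csub s)"
  unfolding csub_def by (rule additive_keys_sum) (simp add: additive_def cst_add distrib_right)

lemma csub_single: "csub s (Poly_Mapping.single k c) = cst c * mev s k"
  unfolding csub_def by (rule keys_sum_single) (simp add: additive_def cst_add distrib_right)

lemma cst_mult: "cst ((c::complex) * d) = cst c * cst d"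
  by (simp add: cst_def mult_single)

lemma csub_add: "csub s (P + Q) = csub s P + csub s Q"
  by (rule additive.add[OF additive_csub])

lemma csub_mult: "csub s (P * Q) = csub s P * csub s Q"
proof (rule additive_eqI[of "\<lambda>P. csub s (P * Q)" "\<lambda>P. csub s P * csub s Q"])
  fix k and c :: complex
  let ?P = "Poly_Mapping.single k c :: complex mpoly"
  show "csub s (?P * Q) = csub s ?P * csub s Q"
  proof (rule additive_eqI[of "\<lambda>Q. csub s (?P * Q)" "\<lambda>Q. csub s ?P * csub s Q"])
    fix l d
    show "csub s (?P * Poly_Mapping.single l d) = csub s ?P * csub s (Poly_Mapping.single l d)"
      by (simp add: mult_single csub_single cst_mult mev_add ac_simps)
  qed (simp_all add: additive_def distrib_left csub_add)
qed (simp_all add: additive_def distrib_right csub_add)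

lemma cst_one: "cst (1::complex) = 1"
  by (simp add: cst_def)

lemma csub_one [simp]: "csub s 1 = 1"
  using csub_single[of s 0 1] by (simp add: cst_one)

lemma csub_power: "csub s (Q ^ n) = csub s Q ^ n"
  by (induction n) (simp_all add: csub_mult)

lemma csub_prod: "csub s (\<Prod>i\<in>A. f i) = (\<Prod>i\<in>A. csub s (f i))"
  by (induction A rule: infinite_finite_induct) (simp_all add: csub_mult)

lemma csub_mon: "csub s (mon k) = mev s k"
  by (simp add: mon_def csub_single cst_one)

lemma csub_var [simp]: "csub s (var i) = s i"
  by (simp add: var_def csub_mon mev_single)

lemma csub_cst: "csub s (cst c) = cst c"
  using csub_single[of s 0 c] by (simp add: cst_def)

lemma csub_mev: "csub s (mev t k) = mev (\<lambda>v. csub s (t v)) k"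
  by (simp add: mev_def csub_prod csub_power)

lemma csub_var_id: "csub var Q = Q"
  by (rule additive_eqI[of "csub var" "\<lambda>x. x"])
    (simp_all add: additive_csub csub_single mev_var mon_def cst_def mult_single, simp add: additive_def)

section \<open>Scalar multiplication and extension of maps to polynomials\<close>

locale poly_module = module sm for sm :: "complex poly \<Rightarrow> 'x::ab_group_add \<Rightarrow> 'x"
begin

lemma additive_scale: "additive (sm p)"
  by (simp add: additive_def scale_right_distrib)

lemma additive_scale_left: "additive (\<lambda>c. sm [:c:] x)"
proof
  fix c d show "sm [:c + d:] x = sm [:c:] x + sm [:d:] x"
    using scale_left_distrib[of "[:c:]" "[:d:]" x] by simp
qed

lemma additive_mscale_left: "additive (\<lambda>Q. mscale sm Q P)"
  unfolding mscale_def
  by (rule additive_keys_sum, rule additive_sum)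
    (simp add: additive_def single_add additive.add[OF additive_scale_left])

lemma additive_mscale: "additive (mscale sm Q)"
proof -
  have "additive (\<lambda>P. \<Sum>k\<in>Poly_Mapping.keys P. \<Sum>l\<in>Poly_Mapping.keys Q.
      Poly_Mapping.single (l + k) (sm [:Poly_Mapping.lookup Q l:] (Poly_Mapping.lookup P k)))"
    by (rule additive_keys_sum, rule additive_sum) (simp add: additive_def single_add scale_right_distrib)
  then show ?thesis
    unfolding mscale_def by (subst sum.swap)
qed

lemma mscale_single:
  "mscale sm (Poly_Mapping.single k c) (Poly_Mapping.single l x) = Poly_Mapping.single (k + l) (sm [:c:] x)"
  by (cases "c = 0"; cases "x = 0") (simp_all add: mscale_def)

lemma mscale_mscale: "mscale sm (Q * Q') P = mscale sm Q (mscale sm Q' P)"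
proof (rule additive_eqI[of "\<lambda>P. mscale sm (Q * Q') P" "\<lambda>P. mscale sm Q (mscale sm Q' P)"])
  fix l and x :: 'x
  let ?P = "Poly_Mapping.single l x :: 'x mpoly"
  show "mscale sm (Q * Q') ?P = mscale sm Q (mscale sm Q' ?P)"
  proof (rule additive_eqI[of "\<lambda>Q. mscale sm (Q * Q') ?P" "\<lambda>Q. mscale sm Q (mscale sm Q' ?P)"])
    fix k and c :: complex
    let ?Q = "Poly_Mapping.single k c :: complex mpoly"
    show "mscale sm (?Q * Q') ?P = mscale sm ?Q (mscale sm Q' ?P)"
    proof (rule additive_eqI[of "\<lambda>Q'. mscale sm (?Q * Q') ?P" "\<lambda>Q'. mscale sm ?Q (mscale sm Q' ?P)"])
      fix k' c'
      show "mscale sm (?Q * Poly_Mapping.single k' c') ?P = mscale sm ?Q (mscale sm (Poly_Mapping.single k' c') ?P)"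
        by (simp add: mult_single mscale_single add.assoc mult.commute[of c])
    qed (auto intro: additive_comp additive_mscale additive_mscale_left simp: additive_def distrib_left
        additive.add[OF additive_mscale] additive.add[OF additive_mscale_left])
  qed (auto simp: additive_def distrib_right additive.add[OF additive_mscale_left])
qed (auto intro: additive_comp additive_mscale)

sublocale mscale: module "mscale sm"
proof
  fix P
  show "mscale sm 1 P = P"
  proof (rule additive_eqI[of "mscale sm 1" "\<lambda>x. x"])
    fix k and x :: 'x
    show "mscale sm 1 (Poly_Mapping.single k x) = Poly_Mapping.single k x"
      using mscale_single[of 0 1 k x] by (simp flip: one_pCons)
  qed (simp_all add: additive_mscale, simp add: additive_def)
qed (simp_all add: additive.add[OF additive_mscale] additive.add[OF additive_mscale_left] mscale_mscale)

lemma mscale_cst_cst: "mscale sm (cst c) (cst x) = cst (sm [:c:] x)"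
  by (simp add: cst_def mscale_single)

lemma mscale_mon_cst: "mscale sm (mon k) (cst x) = Poly_Mapping.single k x"
  by (simp add: cst_def mon_def mscale_single flip: one_pCons)

lemma single_eq_mscale: "Poly_Mapping.single k x = mscale sm (mon k) (cst x)"
  by (simp add: mscale_mon_cst)

lemma mscale_sgn_if: "mscale sm q (sgn_if e P) = sgn_if e (mscale sm q P)"
  by (simp add: sgn_if_def)

text \<open>A common bound of summation makes polynomials of different degrees comparable, as needed
  for sums, shifts and images under coefficient maps.\<close>

lemma pextend_bound:
  assumes "additive f" "Polynomial.degree p \<le> N"
  shows "pextend sm q f p = (\<Sum>n\<le>N. mscale sm (q ^ n) (f (poly.coeff p n)))"
  unfolding pextend_def using assms(2)
  by (intro sum.mono_neutral_left) (auto simp: additive.zero[OF assms(1)] coeff_eq_0)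

lemma pextend_add:
  assumes "additive f" shows "pextend sm q f (p + p') = pextend sm q f p + pextend sm q f p'"
proof -
  define N where "N = max (Polynomial.degree p) (Polynomial.degree p')"
  have "Polynomial.degree (p + p') \<le> N" "Polynomial.degree p \<le> N" "Polynomial.degree p' \<le> N"
    by (simp_all add: N_def degree_add_le)
  then show ?thesis
    by (simp add: pextend_bound[OF assms] additive.add[OF assms] mscale.scale_right_distrib sum.distrib)
qed

lemma additive_pextend: "additive f \<Longrightarrow> additive (pextend sm q f)"
  by (simp add: additive_def pextend_add)

lemma pextend_pCons:
  assumes "additive f" shows "pextend sm q f (pCons 0 p) = mscale sm q (pextend sm q f p)"
proof -
  have "pextend sm q f (pCons 0 p) = (\<Sum>n\<le>Suc (Polynomial.degree p). mscale sm (q ^ n) (f (poly.coeff (pCons 0 p) n)))"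
    by (rule pextend_bound[OF assms degree_pCons_le])
  also have "\<dots> = (\<Sum>n\<le>Polynomial.degree p. mscale sm (q ^ Suc n) (f (poly.coeff p n)))"
    by (simp add: sum.atMost_Suc_shift additive.zero[OF assms] del: sum.atMost_Suc)
  finally show ?thesis
    by (simp add: pextend_def mscale.scale_sum_right)
qed

lemma pextend_const: "pextend sm q f [:c:] = f c"
  by (simp add: pextend_def)

lemma pextend_map:
  assumes "additive f" "additive h" shows "pextend sm q f (map_poly h p) = pextend sm q (\<lambda>x. f (h x)) p"
proof -
  have "pextend sm q f (map_poly h p) = (\<Sum>n\<le>Polynomial.degree p. mscale sm (q ^ n) (f (poly.coeff (map_poly h p) n)))"
    by (rule pextend_bound[OF assms(1) map_poly_degree_leq])
  then show ?thesis
    by (simp add: coeff_map_poly additive.zero[OF assms(2)] pextend_def)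
qed

lemma pextend_mscale: "pextend sm q (\<lambda>x. mscale sm r (f x)) p = mscale sm r (pextend sm q f p)"
  unfolding pextend_def mscale.scale_sum_right by (simp add: mult.commute)

lemma pextend_uminus: "pextend sm q (\<lambda>x. - f x) p = - pextend sm q f p"
  by (simp add: pextend_def sum_negf)

end

locale two_modules = X: poly_module smX + Y: poly_module smY
  for smX :: "complex poly \<Rightarrow> 'x::ab_group_add \<Rightarrow> 'x" and smY :: "complex poly \<Rightarrow> 'y::ab_group_add \<Rightarrow> 'y"
begin

text \<open>Only numbers have to pass through f. The action of \<partial> is left free, since the
  functions in question turn it into multiplication by a polynomial.\<close>

definition clin :: "('x \<Rightarrow> 'y mpoly) \<Rightarrow> bool" where
  "clin f \<longleftrightarrow> additive f \<and> (\<forall>c x. f (smX [:c:] x) = mscale smY (cst c) (f x))"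

text \<open>Substitutes s for the variables while applying f to the coefficients. The choice
  \<open>f = cst\<close> gives \<open>msubst\<close>, and \<open>s = var\<close> with the
  \<lambda>-action for f gives \<open>rho_ext\<close>.\<close>

definition ext :: "(nat \<Rightarrow> complex mpoly) \<Rightarrow> ('x \<Rightarrow> 'y mpoly) \<Rightarrow> 'x mpoly \<Rightarrow> 'y mpoly" where
  "ext s f P = (\<Sum>k \<in> Poly_Mapping.keys P. mscale smY (mev s k) (f (Poly_Mapping.lookup P k)))"

lemma additive_ext: "additive f \<Longrightarrow> additive (ext s f)"
  unfolding ext_def
  by (rule additive_keys_sum[where \<Phi> = "\<lambda>k x. mscale smY (mev s k) (f x)"]) (rule additive_comp[OF Y.additive_mscale])

lemma ext_single: "additive f \<Longrightarrow> ext s f (Poly_Mapping.single k x) = mscale smY (mev s k) (f x)"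
  unfolding ext_def
  by (rule keys_sum_single[where \<Phi> = "\<lambda>k x. mscale smY (mev s k) (f x)"]) (rule additive_comp[OF Y.additive_mscale])

lemma ext_cst: "additive f \<Longrightarrow> ext s f (cst x) = f x"
  by (simp add: cst_def ext_single)

lemma ext_mscale:
  assumes "clin f" shows "ext s f (mscale smX Q P) = mscale smY (csub s Q) (ext s f P)"
proof -
  have f: "additive f" using assms by (simp add: clin_def)
  show ?thesis
  proof (rule additive_eqI[of "\<lambda>P. ext s f (mscale smX Q P)" "\<lambda>P. mscale smY (csub s Q) (ext s f P)"])
    fix l and x :: 'x
    let ?P = "Poly_Mapping.single l x :: 'x mpoly"
    show "ext s f (mscale smX Q ?P) = mscale smY (csub s Q) (ext s f ?P)"
    proof (rule additive_eqI[of "\<lambda>Q. ext s f (mscale smX Q ?P)" "\<lambda>Q. mscale smY (csub s Q) (ext s f ?P)"])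
      fix k c
      show "ext s f (mscale smX (Poly_Mapping.single k c) ?P) = mscale smY (csub s (Poly_Mapping.single k c)) (ext s f ?P)"
        using assms by (simp add: X.mscale_single ext_single[OF f] csub_single mev_add clin_def ac_simps)
    qed (simp_all add: additive_def additive.add[OF additive_csub] additive.add[OF additive_ext[OF f]]
        X.mscale.scale_left_distrib Y.mscale.scale_left_distrib)
  qed (simp_all add: additive_def additive.add[OF additive_ext[OF f]]
      X.mscale.scale_right_distrib Y.mscale.scale_right_distrib)
qed

lemma ext_pextend:
  assumes "clin f"
  shows "ext s f (pextend smX q g p) = pextend smY (csub s q) (\<lambda>x. ext s f (g x)) p"
proof -
  have "additive (ext s f)" using assms by (simp add: clin_def additive_ext)
  then show ?thesis
    by (simp add: pextend_def additive.sum ext_mscale[OF assms] csub_power)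
qed

lemma ext_sgn_if:
  assumes "additive f" shows "ext s f (sgn_if e P) = sgn_if e (ext s f P)"
  by (simp add: sgn_if_def additive.minus[OF additive_ext[OF assms]])

text \<open>Under f, -\<partial> becomes q + r, and -\<lambda> becomes -q; what remains is
  r.\<close>

lemma pextend_neg_del_lam:
  assumes "additive f" "\<And>x. f (smX [:0, 1:] x) = - mscale smY (q + r) (f x)"
  shows "pextend smY q f (neg_del_lam smX p) = mscale smY r (pextend smY q f p)"
proof -
  have add: "additive (pextend smY q f)" by (rule Y.additive_pextend[OF assms(1)])
  have "pextend smY q f (map_poly (smX [:0, 1:]) p) = pextend smY q (\<lambda>x. - mscale smY (q + r) (f x)) p"
    by (simp only: Y.pextend_map[OF assms(1) X.additive_scale] assms(2))
  also have "\<dots> = - mscale smY (q + r) (pextend smY q f p)"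
    by (simp only: Y.pextend_uminus Y.pextend_mscale)
  finally show ?thesis
    by (simp add: neg_del_lam_def additive.diff[OF add] additive.minus[OF add]
        Y.pextend_pCons[OF assms(1)] Y.mscale.scale_left_distrib)
qed

text \<open>This is the point at which the substitution in C2 turns into an exchange of the two
  polynomials q and r.\<close>

lemma pextend_subst_neg_del_lam:
  assumes "additive f" "\<And>x. f (smX [:0, 1:] x) = - mscale smY (q + r) (f x)"
  shows "pextend smY q f (subst_neg_del_lam smX p) = pextend smY r f p"
proof -
  have "pextend smY q f ((neg_del_lam smX ^^ n) p) = mscale smY (r ^ n) (pextend smY q f p)" for n p
    by (induction n) (simp_all add: pextend_neg_del_lam[OF assms])
  then show ?thesis
    by (simp add: subst_neg_del_lam_def additive.sum[OF Y.additive_pextend[OF assms(1)]] Y.pextend_const pextend_def[of smY r])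
qed

end

context poly_module
begin

sublocale self: two_modules sm sm ..

lemma clin_cst: "self.clin cst"
  by (simp add: self.clin_def additive_cst mscale_cst_cst)

lemma msubst_ext: "msubst sm s P = self.ext s cst P"
  by (simp add: msubst_def self.ext_def mev_def)

lemma additive_msubst: "additive (msubst sm s)"
  using self.additive_ext[OF additive_cst] by (simp add: msubst_ext additive_def)

lemma msubst_single: "msubst sm s (Poly_Mapping.single k x) = mscale sm (mev s k) (cst x)"
  by (simp add: msubst_ext self.ext_single additive_cst)

lemma msubst_cst: "msubst sm s (cst x) = cst x"
  by (simp add: msubst_ext self.ext_cst additive_cst)

lemma msubst_mscale: "msubst sm s (mscale sm Q P) = mscale sm (csub s Q) (msubst sm s P)"
  by (simp add: msubst_ext self.ext_mscale clin_cst)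

lemma msubst_sgn_if: "msubst sm s (sgn_if e P) = sgn_if e (msubst sm s P)"
  by (simp add: msubst_ext self.ext_sgn_if additive_cst)

lemma msubst_pextend:
  "msubst sm s (pextend sm q g p) = pextend sm (csub s q) (\<lambda>x. msubst sm s (g x)) p"
  by (simp add: pextend_def additive.sum[OF additive_msubst] msubst_mscale csub_power)

lemma msubst_msubst: "msubst sm s (msubst sm t P) = msubst sm (\<lambda>v. csub s (t v)) P"
  by (rule additive_eqI[of "\<lambda>P. msubst sm s (msubst sm t P)" "msubst sm (\<lambda>v. csub s (t v))"])
    (simp_all add: additive_comp additive_msubst msubst_single msubst_mscale msubst_cst csub_mev)

text \<open>\<open>qs ! v\<close> is unspecified beyond the end of the list; bounding the variables
  of P keeps such values from entering.\<close>

lemma msubst_cong: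
  assumes "P \<in> mpolys_in n" "\<And>v. v < n \<Longrightarrow> s v = t v"
  shows "msubst sm s P = msubst sm t P"
proof -
  have "s v = t v" if "k \<in> Poly_Mapping.keys P" "v \<in> Poly_Mapping.keys k" for k v
    using assms that by (fastforce simp: mpolys_in_def)
  then show ?thesis
    by (simp add: msubst_def cong: sum.cong prod.cong)
qed

end

section \<open>Polynomials in finitely many variables with graded coefficients\<close>

lemma mpolys_in_zero: "0 \<in> mpolys_in n"
  by (simp add: mpolys_in_def)

lemma mpolys_in_add: "P \<in> mpolys_in n \<Longrightarrow> Q \<in> mpolys_in n \<Longrightarrow> P + Q \<in> mpolys_in n"
  using Poly_Mapping.keys_add[of P Q] by (auto simp: mpolys_in_def)

lemma mpolys_in_sum: "(\<And>i. i \<in> I \<Longrightarrow> f i \<in> mpolys_in n) \<Longrightarrow> (\<Sum>i\<in>I. f i) \<in> mpolys_in n"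
  by (induction I rule: infinite_finite_induct) (auto intro: mpolys_in_zero mpolys_in_add)

lemma mpolys_in_uminus: "P \<in> mpolys_in n \<Longrightarrow> - P \<in> mpolys_in n" for P :: "'x::ab_group_add mpoly"
  by (simp add: mpolys_in_def in_keys_iff)

lemma mpolys_in_single: "Poly_Mapping.keys k \<subseteq> {..<n} \<Longrightarrow> Poly_Mapping.single k x \<in> mpolys_in n"
  by (simp add: mpolys_in_def)

lemma mpolys_in_mult:
  fixes P Q :: "complex mpoly"
  assumes "P \<in> mpolys_in n" "Q \<in> mpolys_in n" shows "P * Q \<in> mpolys_in n"
  unfolding mpolys_in_def
proof (safe)
  fix k v assume "k \<in> Poly_Mapping.keys (P * Q)" and v: "v \<in> Poly_Mapping.keys k"
  then obtain i j where "k = i + j" "i \<in> Poly_Mapping.keys P" "j \<in> Poly_Mapping.keys Q"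
    using Poly_Mapping.keys_mult[of P Q] by blast
  then show "v < n"
    using assms v Poly_Mapping.keys_add[of i j] by (fastforce simp: mpolys_in_def)
qed

lemma mpolys_in_one: "(1 :: complex mpoly) \<in> mpolys_in n"
  using mpolys_in_single[of 0 n "1 :: complex"] by simp

lemma mpolys_in_prod: "(\<And>i. i \<in> A \<Longrightarrow> f i \<in> mpolys_in n) \<Longrightarrow> (\<Prod>i\<in>A. f i) \<in> mpolys_in n"
  for f :: "'i \<Rightarrow> complex mpoly"
  by (induction A rule: infinite_finite_induct) (auto intro: mpolys_in_one mpolys_in_mult)

lemma mpolys_in_power: "P \<in> mpolys_in n \<Longrightarrow> P ^ m \<in> mpolys_in n" for P :: "complex mpoly"
  by (induction m) (auto intro: mpolys_in_one mpolys_in_mult)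

lemma mpolys_in_mon: "Poly_Mapping.keys k \<subseteq> {..<n} \<Longrightarrow> mon k \<in> mpolys_in n"
  by (simp add: mon_def mpolys_in_single)

lemma mpolys_in_var: "i < n \<Longrightarrow> var i \<in> mpolys_in n"
  by (simp add: var_def mpolys_in_mon)

lemma mpolys_in_mev:
  assumes "\<And>v. v \<in> Poly_Mapping.keys k \<Longrightarrow> s v \<in> mpolys_in n" shows "mev s k \<in> mpolys_in n"
  unfolding mev_def by (intro mpolys_in_prod mpolys_in_power assms)

sublocale graded_module \<subseteq> poly_module sm ..

context graded_module
begin

definition gpolys :: "nat \<Rightarrow> bit \<Rightarrow> 'x mpoly set" where
  "gpolys n e = {P \<in> mpolys_in n. \<forall>k. Poly_Mapping.lookup P k \<in> G e}"

lemma gpolys_zero: "0 \<in> gpolys n e"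
  using subspace_0[OF subspace_G] by (simp add: gpolys_def mpolys_in_zero)

lemma gpolys_add: "P \<in> gpolys n e \<Longrightarrow> Q \<in> gpolys n e \<Longrightarrow> P + Q \<in> gpolys n e"
  using subspace_add[OF subspace_G] by (simp add: gpolys_def mpolys_in_add lookup_add)

lemma gpolys_uminus: "P \<in> gpolys n e \<Longrightarrow> - P \<in> gpolys n e"
  using subspace_neg[OF subspace_G] by (simp add: gpolys_def mpolys_in_uminus)

lemma gpolys_sum: "(\<And>i. i \<in> I \<Longrightarrow> f i \<in> gpolys n e) \<Longrightarrow> (\<Sum>i\<in>I. f i) \<in> gpolys n e"
  by (induction I rule: infinite_finite_induct) (auto intro: gpolys_zero gpolys_add)

lemma gpolys_single: "Poly_Mapping.keys k \<subseteq> {..<n} \<Longrightarrow> x \<in> G e \<Longrightarrow> Poly_Mapping.single k x \<in> gpolys n e"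
  using subspace_0[OF subspace_G] by (simp add: gpolys_def mpolys_in_single lookup_single when_def)

lemma gpolys_cst: "x \<in> G e \<Longrightarrow> cst x \<in> gpolys n e"
  by (simp add: cst_def gpolys_single)

lemma gpolys_mscale:
  assumes "Q \<in> mpolys_in n" "P \<in> gpolys n e" shows "mscale sm Q P \<in> gpolys n e"
  unfolding mscale_def
proof (intro gpolys_sum gpolys_single)
  fix k l assume "k \<in> Poly_Mapping.keys Q" "l \<in> Poly_Mapping.keys P"
  then have "Poly_Mapping.keys k \<subseteq> {..<n}" "Poly_Mapping.keys l \<subseteq> {..<n}"
    using assms by (auto simp: mpolys_in_def gpolys_def)
  then show "Poly_Mapping.keys (k + l) \<subseteq> {..<n}"
    using Poly_Mapping.keys_add[of k l] by blast
  show "sm [:Poly_Mapping.lookup Q k:] (Poly_Mapping.lookup P l) \<in> G e"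
    using assms subspace_scale[OF subspace_G] by (simp add: gpolys_def)
qed

lemma gpolys_pextend:
  assumes "q \<in> mpolys_in n" "\<And>i. f (poly.coeff p i) \<in> gpolys n e"
  shows "pextend sm q f p \<in> gpolys n e"
  unfolding pextend_def by (intro gpolys_sum gpolys_mscale mpolys_in_power assms)

end

section \<open>Sesquilinearity of the bracket in its second argument\<close>

context lie_conformal_superalgebra
begin

lemma additive_map_poly: "additive h \<Longrightarrow> additive (map_poly h)" for h :: "'r \<Rightarrow> 'r"
  by (simp add: additive_def poly_eq_iff coeff_map_poly additive.zero)

text \<open>C2 turns the second argument into the first, where C1 applies. The resulting factor is
  substituted as well and becomes \<open>neg_del_lam\<close>, applied to what C2 identifies with the
  original bracket up to sign. The general case follows by splitting both arguments into homogeneous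
  parts.\<close>

lemma br_del_right: "br a (sm [:0, 1:] b) = map_poly (sm [:0, 1:]) (br a b) + pCons 0 (br a b)"
proof -
  let ?d = "sm [:0, 1:]"
  have add: "additive (map_poly ?d)"
    by (rule additive_map_poly[OF additive_scale])
  have pCons: "additive (pCons (0 :: 'r))"
    by (simp add: additive_def)
  have ndl: "additive (neg_del_lam sm)"
    by (simp add: neg_del_lam_def additive_def additive.add[OF add] additive.add[OF pCons] del: add_pCons diff_pCons minus_pCons)
  have hom: "br a (?d b) = map_poly ?d (br a b) + pCons 0 (br a b)" if "a \<in> G d" "b \<in> G e" for a b d e
  proof -
    have db: "?d b \<in> G e"
      using that subspace_scale[OF subspace_G] by blast
    have ndl_pow: "additive ((neg_del_lam sm ^^ n))" for n
      by (induction n) (simp_all add: additive_def additive.add[OF ndl])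
    \<comment> \<open>Multiplying by the variable before the substitution amounts to one more
      application of \<open>neg_del_lam\<close> after it.\<close>
    have "subst_neg_del_lam sm (- pCons 0 p) = - neg_del_lam sm (subst_neg_del_lam sm p)" for p
    proof -
      have bound: "subst_neg_del_lam sm p = (\<Sum>n\<le>N. (neg_del_lam sm ^^ n) [:poly.coeff p n:])"
        if "Polynomial.degree p \<le> N" for p N
        unfolding subst_neg_del_lam_def using that
        by (intro sum.mono_neutral_left) (auto simp: coeff_eq_0 additive.zero[OF ndl_pow])
      have neg: "(neg_del_lam sm ^^ n) [:- c:] = - (neg_del_lam sm ^^ n) [:c:]" for n c
        using additive.minus[OF ndl_pow, of n "[:c:]"] by simp
      have "subst_neg_del_lam sm (- pCons 0 p) =
          (\<Sum>n\<le>Suc (Polynomial.degree p). (neg_del_lam sm ^^ n) [:poly.coeff (- pCons 0 p) n:])"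
        by (rule bound) (metis degree_minus degree_pCons_le)
      also have "\<dots> = (\<Sum>n\<le>Polynomial.degree p. - neg_del_lam sm ((neg_del_lam sm ^^ n) [:poly.coeff p n:]))"
        by (simp add: sum.atMost_Suc_shift additive.minus[OF ndl] neg del: sum.atMost_Suc)
      finally show ?thesis
        by (simp add: subst_neg_del_lam_def sum_negf additive.sum[OF ndl])
    qed
    then show ?thesis
      using C2[OF that] C2[OF that(1) db] 
      by (simp add: C1 sgn_if_def neg_del_lam_def additive.minus[OF add] additive.minus[OF pCons] del: minus_pCons)
  qed
  obtain a0 a1 b0 b1 where "a0 \<in> G 0" "a1 \<in> G 1" "a = a0 + a1" "b0 \<in> G 0" "b1 \<in> G 1" "b = b0 + b1"
    using G_sum[of a] G_sum[of b] by blast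
  then show ?thesis
    using hom[of a0 0 b0 0] hom[of a0 0 b1 1] hom[of a1 1 b0 0] hom[of a1 1 b1 1]
    by (simp add: br_add_left br_add_right scale_right_distrib additive.add[OF add] additive.add[OF pCons] del: add_pCons)
qed

end

section \<open>The Lie superalgebra of arguments with substituted variables\<close>

text \<open>
  An element together with the polynomial to be substituted for its variable.  The degree is
  recorded separately because \<open>0\<close> is homogeneous of both degrees.
\<close>

type_synonym 'r targ = "bit \<times> 'r \<times> complex mpoly"

definition tsubst :: "(nat \<Rightarrow> complex mpoly) \<Rightarrow> 'r targ \<Rightarrow> 'r targ" where
  "tsubst s = (\<lambda>(e, x, q). (e, x, csub s q))"

lemma fst_tsubst [simp]: "fst (tsubst s a) = fst a"
  by (simp add: tsubst_def split: prod.split)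

context conformal_module
begin

sublocale RM: two_modules smR smM ..

text \<open>The identification of \<open>(\<partial>a, q)\<close> with \<open>-q (a, q)\<close> is
  imposed on functions of pairs, so no quotient of the pairs has to be formed.\<close>

definition lin :: "('r targ \<Rightarrow> 'm mpoly) \<Rightarrow> bool" where
  "lin f \<longleftrightarrow> (\<forall>e q. RM.clin (\<lambda>x. f (e, x, q)) \<and>
     (\<forall>x. f (e, smR [:0, 1:] x, q) = - mscale smM q (f (e, x, q))))"

definition thom :: "'r targ set" where
  "thom = {(e, x, q). x \<in> GR e}"

text \<open>Together with \<open>tcf\<close> and \<open>tel\<close> this encodes the bracket at
  \<open>\<lambda> = q\<close>: the n-th coefficient has weight \<open>q ^ n\<close>, and each
  coefficient carries the polynomial \<open>q + r\<close>.\<close>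

definition tidx :: "'r targ \<Rightarrow> 'r targ \<Rightarrow> nat set" where
  "tidx = (\<lambda>(d, a, q) (e, b, r). {..Polynomial.degree (br a b)})"

definition tcf :: "'r targ \<Rightarrow> 'r targ \<Rightarrow> nat \<Rightarrow> complex mpoly" where
  "tcf = (\<lambda>(d, a, q) (e, b, r) n. q ^ n)"

definition tel :: "'r targ \<Rightarrow> 'r targ \<Rightarrow> nat \<Rightarrow> 'r targ" where
  "tel = (\<lambda>(d, a, q) (e, b, r) n. (d + e, poly.coeff (br a b) n, q + r))"

definition trho :: "'r targ \<Rightarrow> 'm mpoly \<Rightarrow> 'm mpoly" where
  "trho = (\<lambda>(e, a, q) P. rho_ext smM rho a q P)"

lemma clin_rho: "M.self.clin (\<lambda>m. pextend smM q cst (rho a m))"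
  unfolding M.self.clin_def
proof (intro conjI allI)
  show "additive (\<lambda>m. pextend smM q cst (rho a m))"
    by (simp add: additive_def rho_add_right M.pextend_add[OF additive_cst])
  fix c x
  show "pextend smM q cst (rho a (smM [:c:] x)) = mscale smM (cst c) (pextend smM q cst (rho a x))"
    by (simp add: rho_scale_right M.pextend_map[OF additive_cst M.additive_scale] M.pextend_mscale
        flip: M.mscale_cst_cst)
qed

lemma rho_ext_ext: "rho_ext smM rho a q P = M.self.ext var (\<lambda>m. pextend smM q cst (rho a m)) P"
  by (simp add: rho_ext_def M.self.ext_def mev_var)

lemma additive_rho_ext: "additive (rho_ext smM rho a q)"
  using M.self.additive_ext[of _ var] clin_rho[of q a]
  by (simp add: M.self.clin_def rho_ext_ext additive_def)

lemma rho_ext_mscale: "rho_ext smM rho a q (mscale smM Q P) = mscale smM Q (rho_ext smM rho a q P)"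
  by (simp add: rho_ext_ext M.self.ext_mscale[OF clin_rho] csub_var_id)

lemma rho_ext_cst: "rho_ext smM rho a q (cst m) = pextend smM q cst (rho a m)"
  using clin_rho[of q a] by (simp add: rho_ext_ext M.self.ext_cst M.self.clin_def)

lemma rho_ext_pextend:
  "rho_ext smM rho a q (pextend smM r f p) = pextend smM r (\<lambda>x. rho_ext smM rho a q (f x)) p"
  by (simp add: pextend_def additive.sum[OF additive_rho_ext] rho_ext_mscale)

lemma rho_ext_single: "rho_ext smM rho a q (Poly_Mapping.single k m) = mscale smM (mon k) (pextend smM q cst (rho a m))"
  by (simp add: M.single_eq_mscale rho_ext_mscale rho_ext_cst)

sublocale ops: super_cartan_ops fst thom tidx tcf tel "mscale smM" trho
proof
  fix a b :: "'r targ" and i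
  assume "a \<in> thom" "b \<in> thom"
  then show "tel a b i \<in> thom"
    by (auto simp: thom_def tel_def R.br_graded)
qed (auto simp: M.mscale.scale_right_distrib mult.commute trho_def tel_def rho_ext_mscale
    additive.add[OF additive_rho_ext] split: prod.splits)

lemma Br_pextend: "ops.Br (d, a, q) (e, b, r) f = pextend smM q (\<lambda>x. f (d + e, x, q + r)) (br a b)"
  unfolding ops.Br_def by (simp add: tidx_def tcf_def tel_def pextend_def)

lemma linD:
  assumes "lin f"
  shows "RM.clin (\<lambda>x. f (e, x, q))" "additive (\<lambda>x. f (e, x, q))"
    "f (e, smR [:c:] x, q) = mscale smM (cst c) (f (e, x, q))"
    "f (e, smR [:0, 1:] x, q) = - mscale smM q (f (e, x, q))"
  using assms unfolding lin_def RM.clin_def by auto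

lemma linI:
  assumes "\<And>e q x y. f (e, x + y, q) = f (e, x, q) + f (e, y, q)"
    and "\<And>e q c x. f (e, smR [:c:] x, q) = mscale smM (cst c) (f (e, x, q))"
    and "\<And>e q x. f (e, smR [:0, 1:] x, q) = - mscale smM q (f (e, x, q))"
  shows "lin f"
  using assms unfolding lin_def RM.clin_def additive_def by blast

text \<open>Substituting q and r for the two variables of \<open>rho_br\<close> gives the identity
  at constants. It extends to monomials because every term is linear over polynomials, and to all
  values by additivity.\<close>

lemma trho_rep:
  assumes "a \<in> thom" "b \<in> thom"
  shows "trho a (trho b v) - sgn_if (fst a * fst b) (trho b (trho a v)) = ops.Br a b (\<lambda>x. trho x v)"
proof -
  obtain d x q e y r where ab: "a = (d, x, q)" "b = (e, y, r)" and x: "x \<in> GR d" and y: "y \<in> GR e"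
    using assms by (auto simp: thom_def)
  \<comment> \<open>The substitution is simultaneous, so q and r may themselves contain
    \<open>var 0\<close> and \<open>var 1\<close>.\<close>
  let ?s = "\<lambda>i. if i = 0 then q else r"
  have "M.self.ext ?s cst (pextend smM (var 1) (\<lambda>z. pextend smM (var 0) cst (rho x z)) (rho y m) -
      sgn_if (d * e) (pextend smM (var 0) (\<lambda>z. pextend smM (var 1) cst (rho y z)) (rho x m))) =
    M.self.ext ?s cst (pextend smM (var 0) (\<lambda>z. pextend smM (var 0 + var 1) cst (rho z m)) (br x y))" for m
    using rho_br[OF x y, of m] by simp
  then have cst: "pextend smM r (\<lambda>z. pextend smM q cst (rho x z)) (rho y m) -
      sgn_if (d * e) (pextend smM q (\<lambda>z. pextend smM r cst (rho y z)) (rho x m)) =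
    pextend smM q (\<lambda>z. pextend smM (q + r) cst (rho z m)) (br x y)" for m
    by (simp add: additive.diff[OF M.additive_msubst] M.msubst_sgn_if M.msubst_pextend M.msubst_cst csub_add
        flip: M.msubst_ext)
  show ?thesis
  proof (rule additive_eqI[of "\<lambda>v. trho a (trho b v) - sgn_if (fst a * fst b) (trho b (trho a v))"
        "\<lambda>v. ops.Br a b (\<lambda>x. trho x v)"])
    fix k m
    have "trho a (trho b (cst m)) - sgn_if (fst a * fst b) (trho b (trho a (cst m))) = ops.Br a b (\<lambda>x. trho x (cst m))"
      using cst[of m] by (simp add: ab trho_def Br_pextend rho_ext_cst rho_ext_pextend)
    then have "mscale smM (mon k) (trho a (trho b (cst m)) - sgn_if (fst a * fst b) (trho b (trho a (cst m))))
        = mscale smM (mon k) (ops.Br a b (\<lambda>x. trho x (cst m)))"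
      by simp
    then show "trho a (trho b (Poly_Mapping.single k m)) - sgn_if (fst a * fst b) (trho b (trho a (Poly_Mapping.single k m)))
        = ops.Br a b (\<lambda>x. trho x (Poly_Mapping.single k m))"
      by (simp add: M.single_eq_mscale ops.\<rho>_act ops.act_sgn ops.Br_act M.mscale.scale_right_diff_distrib)
  qed (simp_all add: additive_def ops.\<rho>_add ops.Br_add sgn_if_add)
qed

text \<open>All three double brackets carry the same degree and the same polynomial
  \<open>q + r + t\<close>. Hence f acts through the single map \<open>?f\<close>, which can be
  applied to the coefficients of both sides of C3.\<close>

lemma br_jacobi:
  assumes "a \<in> thom" "b \<in> thom" "c \<in> thom" "lin f"
  shows "ops.Br b c (\<lambda>x. ops.Br a x f) =
    ops.Br a b (\<lambda>x. ops.Br x c f) + sgn_if (fst a * fst b) (ops.Br a c (\<lambda>x. ops.Br b x f))"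
proof -
  obtain d x q e y r g z t where abc: "a = (d, x, q)" "b = (e, y, r)" "c = (g, z, t)"
    and x: "x \<in> GR d" and y: "y \<in> GR e"
    using assms by (auto simp: thom_def)
  let ?s = "\<lambda>i. if i = 0 then q else r"
  let ?f = "\<lambda>w. f (d + e + g, w, q + r + t)"
  have lin: "RM.clin ?f" and add: "additive ?f"
    using linD[OF assms(4)] by auto
  have "RM.ext ?s ?f (pextend smR (var 1) (\<lambda>w. pextend smR (var 0) cst (br x w)) (br y z)) =
    RM.ext ?s ?f (pextend smR (var 0) (\<lambda>w. pextend smR (var 0 + var 1) cst (br w z)) (br x y) +
      sgn_if (d * e) (pextend smR (var 0) (\<lambda>w. pextend smR (var 1) cst (br y w)) (br x z)))"
    using R.C3[OF x y, of z] by simp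
  then have "pextend smM r (\<lambda>w. pextend smM q ?f (br x w)) (br y z) =
    pextend smM q (\<lambda>w. pextend smM (q + r) ?f (br w z)) (br x y) +
      sgn_if (d * e) (pextend smM q (\<lambda>w. pextend smM r ?f (br y w)) (br x z))"
    by (simp add: additive.add[OF RM.additive_ext[OF add]] RM.ext_sgn_if[OF add] RM.ext_pextend[OF lin]
        RM.ext_cst[OF add] csub_add)
  then show ?thesis
    by (simp add: abc Br_pextend ac_simps)
qed

text \<open>The coefficients of either bracket carry \<open>q + r\<close>, so f turns \<partial>
  into \<open>-(q + r)\<close>, exactly the condition under which C2 exchanges q and r.\<close>

lemma br_skew:
  assumes "a \<in> thom" "b \<in> thom" "lin f"
  shows "ops.Br a b f = - sgn_if (fst a * fst b) (ops.Br b a f)"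
proof -
  obtain d x q e y r where ab: "a = (d, x, q)" "b = (e, y, r)" and x: "x \<in> GR d" and y: "y \<in> GR e"
    using assms by (auto simp: thom_def)
  let ?f = "\<lambda>w. f (d + e, w, q + r)"
  have add: "additive ?f" using linD[OF assms(3)] by auto
  have addp: "additive (pextend smM q ?f)" by (rule M.additive_pextend[OF add])
  have "pextend smM q ?f (br x y) = - sgn_if (d * e) (pextend smM q ?f (subst_neg_del_lam smR (br y x)))"
    by (subst R.C2[OF x y]) (simp add: additive_apply_sgn_if[OF addp] additive.minus[OF addp])
  also have "pextend smM q ?f (subst_neg_del_lam smR (br y x)) = pextend smM r ?f (br y x)"
    by (rule RM.pextend_subst_neg_del_lam[OF add]) (rule linD[OF assms(3)])
  finally show ?thesis
    by (simp add: ab Br_pextend add.commute)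
qed

sublocale cartan: super_cartan fst thom tidx tcf tel "mscale smM" trho lin
proof
  fix f g assume "lin f" "lin g"
  then show "lin (\<lambda>x. f x - g x)"
    by (intro linI) (simp_all add: linD additive.add[OF linD(2)] M.mscale.scale_right_diff_distrib)
next
  fix f :: "'r targ \<Rightarrow> 'm mpoly" and \<phi> assume "lin f"
  then show "lin (\<lambda>x. sgn_if (\<phi> (fst x)) (f x))"
    by (intro linI) (simp_all add: linD additive.add[OF linD(2)] sgn_if_simps M.mscale_sgn_if)
next
  fix f a assume "lin f"
  then show "lin (\<lambda>x. trho a (f x))"
    by (intro linI) (simp_all add: linD additive.add[OF linD(2)] ops.\<rho>_add ops.\<rho>_act ops.\<rho>_simps)
next
  fix f k assume "lin f"
  then show "lin (\<lambda>x. mscale smM k (f x))"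
    by (intro linI) (simp_all add: linD additive.add[OF linD(2)] ops.act_add mult.commute)
next
  fix v
  show "lin (\<lambda>a. trho a v)"
    by (intro linI; simp add: trho_def rho_ext_def rho_add_left rho_scale_left rho_del_left
        M.pextend_add[OF additive_cst] additive.minus[OF M.additive_pextend[OF additive_cst]] M.pextend_pCons[OF additive_cst]
        M.pextend_map[OF additive_cst M.additive_scale] M.pextend_mscale M.mscale.scale_right_distrib sum.distrib
        M.mscale.scale_sum_right sum_negf mult.commute flip: M.mscale_cst_cst)
next
  fix f and b :: "'r targ" assume f: "lin f"
  obtain e y r where b: "b = (e, y, r)" by (cases b)
  show "lin (\<lambda>a. ops.Br a b f)"
    using linD[OF f]
    by (intro linI) (simp_all add: b Br_pextend R.br_add_left R.br_scale_left R.C1 M.pextend_add M.pextend_map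
        R.additive_scale M.pextend_mscale M.pextend_pCons additive.minus[OF M.additive_pextend])
next
  fix f and a :: "'r targ" assume f: "lin f"
  obtain d x q where a: "a = (d, x, q)" by (cases a)
  \<comment> \<open>By \<open>br_del_right\<close>, \<partial> on the second argument contributes
    -(q + r) from the coefficients and +q from the extra factor \<lambda>, in total -r.\<close>
  have "pextend smM q (\<lambda>z. - mscale smM (q + r) (f (e, z, q + r))) p =
      - mscale smM (q + r) (pextend smM q (\<lambda>z. f (e, z, q + r)) p)" for r e p
    by (simp only: M.pextend_uminus M.pextend_mscale)
  then show "lin (\<lambda>b. ops.Br a b f)"
    using linD[OF f]
    by (intro linI) (simp_all add: a Br_pextend R.br_add_right R.br_scale_right R.br_del_right M.pextend_add M.pextend_map
        R.additive_scale M.pextend_mscale M.pextend_pCons M.mscale.scale_left_distrib)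
qed (rule trho_rep br_jacobi br_skew; assumption)+

lemma msubst_trho: "msubst smM s (trho a v) = trho (tsubst s a) (msubst smM s v)"
proof -
  obtain e x q where a: "a = (e, x, q)" by (cases a)
  show ?thesis
    by (rule additive_eqI[of "\<lambda>v. msubst smM s (trho a v)" "\<lambda>v. trho (tsubst s a) (msubst smM s v)"])
      (simp_all add: additive_def ops.\<rho>_add additive.add[OF M.additive_msubst],
        simp add: a trho_def tsubst_def rho_ext_single M.msubst_single M.msubst_mscale M.msubst_pextend M.msubst_cst
          csub_mon rho_ext_mscale rho_ext_cst)
qed

text \<open>Reduces values at arbitrary polynomials to values at the variables.\<close>

lemma msubst_Dif:
  assumes "\<And>bs. msubst smM s (F bs) = F' (map (tsubst s) bs)"
  shows "msubst smM s (ops.Dif \<theta> F as) = ops.Dif \<theta> F' (map (tsubst s) as)"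
proof (rule ops.Dif_natural[where \<sigma> = "msubst smM s" and \<tau> = "tsubst s", OF _ _ msubst_trho])
  fix a b :: "'r targ" and f g :: "'r targ \<Rightarrow> 'm mpoly" assume fg: "\<And>x. msubst smM s (f x) = g (tsubst s x)"
  obtain d x q e y r where "a = (d, x, q)" "b = (e, y, r)" by (cases a; cases b)
  then show "msubst smM s (ops.Br a b f) = ops.Br (tsubst s a) (tsubst s b) g"
    by (simp add: Br_pextend tsubst_def M.msubst_pextend fg csub_add)
qed (simp_all add: assms additive.diff[OF M.additive_msubst])

end

section \<open>Homogeneous components\<close>

lemma sum_bit_lists_Suc:
  fixes g :: "bit list \<Rightarrow> 'x::ab_group_add"
  shows "(\<Sum>es | length es = Suc n. g es) = (\<Sum>es | length es = n. g (0 # es) + g (1 # es))"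
proof -
  let ?A = "{es :: bit list. length es = n}"
  have "{es :: bit list. length es = Suc n} = (#) 0 ` ?A \<union> (#) 1 ` ?A"
  proof (intro set_eqI iffI)
    fix es :: "bit list" assume "es \<in> {es. length es = Suc n}"
    then obtain e es' where "es = e # es'" "length es' = n" by (auto simp: length_Suc_conv)
    then show "es \<in> (#) 0 ` ?A \<union> (#) 1 ` ?A" by (cases e) auto
  qed auto
  then have "(\<Sum>es | length es = Suc n. g es) = (\<Sum>es\<in>(#) 0 ` ?A. g es) + (\<Sum>es\<in>(#) 1 ` ?A. g es)"
    by (simp only:) (rule sum.union_disjoint, auto simp: finite_degree_lists)
  then show ?thesis
    by (simp add: sum.reindex sum.distrib)
qed

context graded_module
begin

lemma hcomp_eqI:
  assumes "y \<in> G e" "x - y \<in> G (e + 1)" shows "hcomp G e x = y"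
  unfolding hcomp_def
proof (rule the_equality)
  fix z assume z: "z \<in> G e \<and> x - z \<in> G (e + 1)"
  have "z - y \<in> G e"
    using z assms subspace_diff[OF subspace_G] by blast
  moreover have "(x - y) - (x - z) \<in> G (e + 1)"
    by (rule subspace_diff[OF subspace_G]) (use z assms in auto)
  then have "z - y \<in> G (e + 1)" by simp
  ultimately have "z - y \<in> G 0 \<inter> G 1" by (cases e) auto
  then show "z = y" using G_Int by simp
qed (use assms in simp)

lemma hcomp_in: "hcomp G e x \<in> G e" "x - hcomp G e x \<in> G (e + 1)"
proof -
  obtain y z where yz: "y \<in> G 0" "z \<in> G 1" "x = y + z" using G_sum by blast
  then have "\<exists>y. y \<in> G e \<and> x - y \<in> G (e + 1)"
    by (cases e) (auto intro: exI[of _ y] exI[of _ z])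
  then obtain y where "y \<in> G e" "x - y \<in> G (e + 1)" by blast
  moreover from this have "hcomp G e x = y" by (rule hcomp_eqI)
  ultimately show "hcomp G e x \<in> G e" "x - hcomp G e x \<in> G (e + 1)" by auto
qed

lemma hcomp_add: "hcomp G e (x + y) = hcomp G e x + hcomp G e y"
proof (rule hcomp_eqI)
  have "(x - hcomp G e x) + (y - hcomp G e y) \<in> G (e + 1)"
    by (intro subspace_add[OF subspace_G] hcomp_in)
  then show "x + y - (hcomp G e x + hcomp G e y) \<in> G (e + 1)"
    by (simp add: algebra_simps)
qed (intro subspace_add[OF subspace_G] hcomp_in)

lemma hcomp_scale: "hcomp G e (sm p x) = sm p (hcomp G e x)"
  by (rule hcomp_eqI)
    (auto intro: subspace_scale[OF subspace_G] hcomp_in simp flip: scale_right_diff_distrib)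

lemma hcomp_hom: "x \<in> G e \<Longrightarrow> hcomp G d x = (if d = e then x else 0)"
  using subspace_0[OF subspace_G]
  by (cases d; cases e; auto intro!: hcomp_eqI)

lemma hcomp_zero [simp]: "hcomp G e 0 = 0"
  using hcomp_hom[of 0 e e] subspace_0[OF subspace_G] by simp

lemma hcomp_sum: "hcomp G 0 x + hcomp G 1 x = x"
proof -
  have "hcomp G 1 x = x - hcomp G 0 x"
    using hcomp_in(1)[of 0 x] hcomp_in(2)[of x 0] by (intro hcomp_eqI) auto
  then show ?thesis by simp
qed

lemma sum_hcomp:
  fixes f :: "'x list \<Rightarrow> 'y::ab_group_add"
  assumes "\<And>as x y bs. f (as @ (x + y) # bs) = f (as @ x # bs) + f (as @ y # bs)"
  shows "(\<Sum>es | length es = length as. f (map2 (hcomp G) es as)) = f as"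
  using assms
proof (induction as arbitrary: f)
  case (Cons a as)
  have "(\<Sum>es | length es = length (a # as). f (map2 (hcomp G) es (a # as))) =
    (\<Sum>es | length es = length as. f (hcomp G 0 a # map2 (hcomp G) es as) + f (hcomp G 1 a # map2 (hcomp G) es as))"
    by (simp add: sum_bit_lists_Suc)
  also have "\<dots> = (\<Sum>es | length es = length as. f (a # map2 (hcomp G) es as))"
    using Cons.prems[of "[]" "hcomp G 0 a" "hcomp G 1 a"] by (simp add: hcomp_sum)
  also have "\<dots> = f (a # as)"
    using Cons.prems[of "a # _"] by (intro Cons.IH[of "\<lambda>as. f (a # as)"]) simp
  finally show ?case .
qed simp

end

section \<open>Cochains\<close>

definition swap_at :: "nat \<Rightarrow> 'x list \<Rightarrow> 'x list" where
  "swap_at i xs = xs[i := xs ! Suc i, Suc i := xs ! i]"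

lemma length_swap_at [simp]: "length (swap_at i xs) = length xs"
  by (simp add: swap_at_def)

lemma nth_swap_at: "Suc i < length xs \<Longrightarrow> j < length xs \<Longrightarrow>
    swap_at i xs ! j = xs ! (if j = i then Suc i else if j = Suc i then i else j)"
  by (simp add: swap_at_def nth_list_update)

lemma swap_at_swap_at: "Suc i < length xs \<Longrightarrow> swap_at i (swap_at i xs) = xs"
  by (rule nth_equalityI) (auto simp: nth_swap_at)

lemma swap_at_append: "swap_at (length as) (as @ a # b # bs) = as @ b # a # bs"
  by (simp add: swap_at_def nth_append list_update_append)

lemma split_at_two: "Suc i < length xs \<Longrightarrow> \<exists>as a b bs. xs = as @ a # b # bs \<and> length as = i"
  by (rule exI[of _ "take i xs"], rule exI[of _ "xs ! i"], rule exI[of _ "xs ! Suc i"], rule exI[of _ "drop (Suc (Suc i)) xs"])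
    (simp add: Cons_nth_drop_Suc)

section \<open>Homogeneous cochains as functions of pairs\<close>

context conformal_module
begin

abbreviation HC :: "nat \<Rightarrow> bit \<Rightarrow> ('r, 'm) cochain set" where
  "HC \<equiv> hom_cochains smR GR smM GM"

context
  fixes n \<theta> and \<gamma> :: "('r, 'm) cochain"
  assumes HC: "\<gamma> \<in> HC n \<theta>"
begin

lemma HC_length: "length as \<noteq> n \<Longrightarrow> \<gamma> as = 0"
  using HC by (simp add: hom_cochains_def)

lemma HC_mpolys_in: "length as = n \<Longrightarrow> \<gamma> as \<in> mpolys_in n"
  using HC by (simp add: hom_cochains_def)

text \<open>Off length n all values vanish, so no length has to be assumed. The list is split at the
  changed entry, as \<open>multilin\<close> requires; in the proof \<open>0\<close> holds the place
  that the update overwrites.\<close>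

lemma HC_add: "\<gamma> (as @ (x + y) # bs) = \<gamma> (as @ x # bs) + \<gamma> (as @ y # bs)"
proof (cases "length (as @ 0 # bs) = n")
  case True
  have "\<forall>as i x y. length as = n \<and> i < n \<longrightarrow> \<gamma> (as[i := x + y]) = \<gamma> (as[i := x]) + \<gamma> (as[i := y])"
    using HC by (simp add: hom_cochains_def)
  from this[rule_format, of "as @ 0 # bs" "length as" x y] show ?thesis
    using True by simp
qed (simp add: HC_length)

lemma HC_scale: "\<gamma> (as @ smR [:c:] x # bs) = mscale smM (cst c) (\<gamma> (as @ x # bs))"
proof (cases "length (as @ 0 # bs) = n")
  case True
  have "\<forall>as i c x. length as = n \<and> i < n \<longrightarrow> \<gamma> (as[i := smR [:c:] x]) = mscale smM (cst c) (\<gamma> (as[i := x]))"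
    using HC by (simp add: hom_cochains_def)
  from this[rule_format, of "as @ 0 # bs" "length as" c x] show ?thesis
    using True by simp
qed (simp add: HC_length)

lemma HC_del: "\<gamma> (as @ smR [:0, 1:] x # bs) = - mscale smM (var (length as)) (\<gamma> (as @ x # bs))"
proof (cases "length (as @ 0 # bs) = n")
  case True
  have "\<forall>as i x. length as = n \<and> i < n \<longrightarrow> \<gamma> (as[i := smR [:0, 1:] x]) = - mscale smM (var i) (\<gamma> (as[i := x]))"
    using HC by (simp add: hom_cochains_def)
  from this[rule_format, of "as @ 0 # bs" "length as" x] show ?thesis
    using True by simp
qed (simp add: HC_length)

lemma HC_graded:
  "length as = n \<Longrightarrow> length es = n \<Longrightarrow> (\<And>i. i < n \<Longrightarrow> as ! i \<in> GR (es ! i)) \<Longrightarrow>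
    Poly_Mapping.lookup (\<gamma> as) k \<in> GM (\<theta> + sum_list es)"
  using HC unfolding hom_cochains_def by blast

lemma HC_skew:
  assumes "a \<in> GR d" "b \<in> GR e" "length (as @ a # b # bs) = n"
  shows "\<gamma> (as @ a # b # bs) = - sgn_if (d * e)
    (cochain_at smM \<gamma> (swap_at (length as) (map var [0..<n])) (as @ b # a # bs))"
proof -
  let ?xs = "as @ a # b # bs" and ?i = "length as"
  have "length ?xs = n \<and> Suc ?i < n \<and> ?xs ! ?i \<in> GR d \<and> ?xs ! Suc ?i \<in> GR e"
    using assms by (auto simp: nth_append)
  then have "\<gamma> ?xs = - sgn_if (d * e)
          (cochain_at smM \<gamma> ((map var [0..<n])[?i := var (Suc ?i), Suc ?i := var ?i])
             (?xs[?i := ?xs ! Suc ?i, Suc ?i := ?xs ! ?i]))"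
    using HC unfolding hom_cochains_def by blast
  moreover have "swap_at ?i (map var [0..<n]) = (map var [0..<n])[?i := var (Suc ?i), Suc ?i := var ?i]"
    using assms by (simp add: swap_at_def)
  ultimately show ?thesis
    by (simp only: swap_at_append[unfolded swap_at_def])
qed

end

text \<open>The degree tag does not enter the value; it is there for the signs in the
  operators.\<close>

definition ev :: "('r, 'm) cochain \<Rightarrow> 'r targ list \<Rightarrow> 'm mpoly" where
  "ev \<gamma> ts = cochain_at smM \<gamma> (map (snd \<circ> snd) ts) (map (fst \<circ> snd) ts)"

lemma ev_length: "\<gamma> \<in> HC n \<theta> \<Longrightarrow> length ts \<noteq> n \<Longrightarrow> ev \<gamma> ts = 0"
  by (simp add: ev_def cochain_at_def HC_length additive.zero[OF M.additive_msubst])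

lemma ev_multilin: "\<gamma> \<in> HC n \<theta> \<Longrightarrow> cartan.multilin (ev \<gamma>)"
  unfolding cartan.multilin_def
  by (intro allI linI)
    (simp_all add: ev_def cochain_at_def HC_add HC_scale HC_del additive.add[OF M.additive_msubst]
      additive.minus[OF M.additive_msubst] M.msubst_mscale csub_cst nth_append)

lemma cochain_at_cochain_at:
  assumes "\<gamma> \<in> HC n \<theta>" "length as = n" "length qs = n"
  shows "msubst smM s (cochain_at smM \<gamma> qs as) = cochain_at smM \<gamma> (map (csub s) qs) as"
  unfolding cochain_at_def M.msubst_msubst
  using assms by (intro M.msubst_cong[OF HC_mpolys_in[OF assms(1)]]) simp_all

text \<open>Skew-symmetry of a cochain is stated at the variables. Substituting the polynomials of
  the pairs into the exchanged variables produces the exchanged list of polynomials.\<close>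

lemma ev_skew:
  assumes "\<gamma> \<in> HC n \<theta>" shows "ops.skew (ev \<gamma>)"
  unfolding ops.skew_def
proof (intro allI impI)
  fix as a b bs assume ab: "a \<in> thom" "b \<in> thom"
  show "ev \<gamma> (as @ a # b # bs) = - sgn_if (fst a * fst b) (ev \<gamma> (as @ b # a # bs))"
  proof (cases "length (as @ a # b # bs) = n")
    case False
    then show ?thesis using ev_length[OF assms] by simp
  next
    case n: True
    obtain d x q e y r where abe: "a = (d, x, q)" "b = (e, y, r)" and x: "x \<in> GR d" and y: "y \<in> GR e"
      using ab by (auto simp: thom_def)
    let ?arg = "map (fst \<circ> snd)" and ?val = "map (snd \<circ> snd)"
    let ?q = "?val as @ q # r # ?val bs"
    let ?s = "\<lambda>v. ?q ! v"
    have "\<gamma> (?arg as @ x # y # ?arg bs) = - sgn_if (d * e)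
      (cochain_at smM \<gamma> (swap_at (length as) (map var [0..<n])) (?arg as @ y # x # ?arg bs))"
      using HC_skew[OF assms x y, of "?arg as" "?arg bs"] n by simp
    then have "ev \<gamma> (as @ a # b # bs) = - sgn_if (d * e) (msubst smM ?s
       (cochain_at smM \<gamma> (swap_at (length as) (map var [0..<n])) (?arg as @ y # x # ?arg bs)))"
      by (simp add: abe ev_def cochain_at_def[of smM \<gamma> ?q] additive.minus[OF M.additive_msubst] M.msubst_sgn_if)
    also have "msubst smM ?s (cochain_at smM \<gamma> (swap_at (length as) (map var [0..<n])) (?arg as @ y # x # ?arg bs))
      = cochain_at smM \<gamma> (map (csub ?s) (swap_at (length as) (map var [0..<n]))) (?arg as @ y # x # ?arg bs)"
      using n by (intro cochain_at_cochain_at[OF assms]) simp_all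
    also have "map (csub ?s) (swap_at (length as) (map var [0..<n])) = swap_at (length as) ?q"
      using n by (intro nth_equalityI) (auto simp: nth_swap_at)
    finally show ?thesis
      using swap_at_append[of "?val as" q r "?val bs"] by (simp add: abe ev_def comp_def)
  qed
qed

definition ghom :: "nat \<Rightarrow> 'r targ set" where
  "ghom N = {(e, x, q). x \<in> GR e \<and> q \<in> mpolys_in N}"

lemma ev_gpolys:
  assumes "\<gamma> \<in> HC n \<theta>" "set ts \<subseteq> ghom N"
  shows "ev \<gamma> ts \<in> M.gpolys N (\<theta> + sum_list (map fst ts))"
proof (cases "length ts = n")
  case False
  then show ?thesis using ev_length[OF assms(1)] M.gpolys_zero by simp
next
  case True
  have ts: "fst (snd (ts ! i)) \<in> GR (fst (ts ! i)) \<and> snd (snd (ts ! i)) \<in> mpolys_in N" if "i < n" for i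
  proof -
    have "ts ! i \<in> ghom N" using that True assms(2) nth_mem by blast
    then show ?thesis by (auto simp: ghom_def)
  qed
  let ?as = "map (fst \<circ> snd) ts" and ?s = "\<lambda>v. map (snd \<circ> snd) ts ! v"
  have "mscale smM (mev ?s k) (cst (Poly_Mapping.lookup (\<gamma> ?as) k)) \<in> M.gpolys N (\<theta> + sum_list (map fst ts))"
    if k: "k \<in> Poly_Mapping.keys (\<gamma> ?as)" for k
  proof (intro M.gpolys_mscale mpolys_in_mev M.gpolys_cst)
    fix v assume "v \<in> Poly_Mapping.keys k"
    then have "v < n"
      using HC_mpolys_in[OF assms(1), of ?as] True k by (auto simp: mpolys_in_def)
    then show "?s v \<in> mpolys_in N" using ts True by simp
  next
    show "Poly_Mapping.lookup (\<gamma> ?as) k \<in> GM (\<theta> + sum_list (map fst ts))"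
      using True ts by (intro HC_graded[OF assms(1)]) simp_all
  qed
  then show ?thesis
    unfolding ev_def cochain_at_def msubst_def by (intro M.gpolys_sum) (simp add: mev_def)
qed

text \<open>The operators bring in only powers of the given polynomials and sums of two of them, so
  no new variable appears.\<close>

lemma Dif_gpolys:
  assumes "\<gamma> \<in> HC n \<theta>" "set ts \<subseteq> ghom N"
  shows "ops.Dif \<theta> (ev \<gamma>) ts \<in> M.gpolys N (\<theta> + sum_list (map fst ts))"
proof (rule ops.Dif_in[where S = "M.gpolys N" and X = "ghom N"])
  fix e a u assume a: "a \<in> ghom N" and u: "u \<in> M.gpolys N e"
  obtain d x q where ax: "a = (d, x, q)" "x \<in> GR d" "q \<in> mpolys_in N" using a by (auto simp: ghom_def)
  have "mscale smM (mon k) (pextend smM q cst (rho x (Poly_Mapping.lookup u k))) \<in> M.gpolys N (e + d)"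
    if "k \<in> Poly_Mapping.keys u" for k
    using ax u that by (intro M.gpolys_mscale mpolys_in_mon M.gpolys_pextend M.gpolys_cst rho_graded)
      (auto simp: M.gpolys_def mpolys_in_def)
  then show "trho a u \<in> M.gpolys N (e + fst a)"
    unfolding ax(1) trho_def by (simp add: rho_ext_def M.gpolys_sum)
next
  fix a b i assume "a \<in> ghom N" "b \<in> ghom N"
  then show "tel a b i \<in> ghom N"
    by (auto simp: ghom_def tel_def R.br_graded mpolys_in_add)
next
  fix a b i e u assume "a \<in> ghom N" "b \<in> ghom N" "u \<in> M.gpolys N e"
  then show "mscale smM (tcf a b i) u \<in> M.gpolys N e"
    by (auto simp: ghom_def tcf_def intro!: M.gpolys_mscale mpolys_in_power)
qed (use assms ev_gpolys in \<open>auto intro: M.gpolys_zero M.gpolys_add M.gpolys_uminus\<close>)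

lemma msubst_ev:
  assumes "\<gamma> \<in> HC n \<theta>" shows "msubst smM s (ev \<gamma> ts) = ev \<gamma> (map (tsubst s) ts)"
proof (cases "length ts = n")
  case True
  then show ?thesis
    unfolding ev_def by (subst cochain_at_cochain_at[OF assms]) (simp_all add: tsubst_def comp_def split_def)
next
  case False
  then show ?thesis by (simp add: ev_length[OF assms] additive.zero[OF M.additive_msubst])
qed

lemma msubst_Dif_ev:
  "\<gamma> \<in> HC n \<theta> \<Longrightarrow> msubst smM s (ops.Dif \<eta> (ev \<gamma>) ts) = ops.Dif \<eta> (ev \<gamma>) (map (tsubst s) ts)"
  by (rule msubst_Dif[where F = "ev \<gamma>" and F' = "ev \<gamma>"]) (rule msubst_ev)

section \<open>The differential of a homogeneous cochain\<close>

definition targs :: "bit list \<Rightarrow> 'r list \<Rightarrow> 'r targ list" where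
  "targs es as = map (\<lambda>j. (es ! j, hcomp GR (es ! j) (as ! j), var j)) [0..<length as]"

lemma length_targs [simp]: "length (targs es as) = length as"
  by (simp add: targs_def)

lemma targs_ghom: "set (targs es as) \<subseteq> ghom (length as)"
  by (auto simp: targs_def ghom_def R.hcomp_in mpolys_in_var)

lemma ghom_thom: "ghom N \<subseteq> thom"
  by (auto simp: ghom_def thom_def)

lemma targs_thom: "set (targs es as) \<subseteq> thom"
  using targs_ghom ghom_thom by blast

lemma map_fst_targs: "length es = length as \<Longrightarrow> map fst (targs es as) = es"
  by (rule nth_equalityI) (simp_all add: targs_def)

lemma targs_update:
  "i < length as \<Longrightarrow> targs es (as[i := x]) =
     take i (targs es as) @ (es ! i, hcomp GR (es ! i) x, var i) # drop (Suc i) (targs es as)"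
  by (subst upd_conv_take_nth_drop[symmetric])
    (auto intro!: nth_equalityI simp: targs_def nth_list_update)

text \<open>Linear extension in the arguments alone, with the degree of the cochain given, so that
  the two homogeneous parts of a cochain can be treated separately.\<close>

definition ext_differential :: "bit \<Rightarrow> ('r, 'm) cochain \<Rightarrow> ('r, 'm) cochain" where
  "ext_differential \<theta> \<gamma> as = (\<Sum>es | length es = length as. hom_differential br smM rho \<theta> es \<gamma> (map2 (hcomp GR) es as))"

text \<open>The explicit formula meets the recursion here: skew-symmetry of the cochain permits
  \<open>Dif_formula\<close>, and at pairs whose polynomials are the variables its terms are the
  prescribed ones.\<close>

lemma hom_differential_eq:
  assumes "\<gamma> \<in> HC n \<theta>" "length es = length as"
  shows "hom_differential br smM rho \<theta> es \<gamma> (map2 (hcomp GR) es as) = ops.Dif \<theta> (ev \<gamma>) (targs es as)"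
proof -
  let ?t = "targs es as"
  define bs where "bs = map2 (hcomp GR) es as"
  have len: "length bs = length as" using assms by (simp add: bs_def)
  have arg: "map (fst \<circ> snd) ?t = bs" and val: "map (snd \<circ> snd) ?t = map var [0..<length bs]"
    using assms by (auto intro!: nth_equalityI simp: targs_def bs_def)
  have nth: "?t ! i = (es ! i, bs ! i, var i)" if "i < length as" for i
    using that assms by (simp add: targs_def bs_def)
  have 1: "trho (?t ! i) (ev \<gamma> (omit i ?t)) =
      rho_ext smM rho (bs ! i) (var i) (cochain_at smM \<gamma> (omit i (map var [0..<length bs])) (omit i bs))"
    if "i < length as" for i
    using that unfolding ev_def omit_map[symmetric] arg val by (simp add: nth trho_def)
  have 2: "ops.Br (?t ! i) (?t ! j) (\<lambda>x. ev \<gamma> (x # omit i (omit j ?t))) =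
     pextend smM (var i) (\<lambda>x. cochain_at smM \<gamma> ((var i + var j) # omit i (omit j (map var [0..<length bs])))
        (x # omit i (omit j bs))) (br (bs ! i) (bs ! j))"
    if "i < j" "j < length as" for i j
    using that by (simp add: nth Br_pextend ev_def omit_map[symmetric] arg[unfolded comp_def] val[unfolded comp_def] comp_def)
  show ?thesis
    unfolding hom_differential_def Let_def bs_def[symmetric]
    by (subst ops.Dif_formula[OF ev_skew[OF assms(1)] targs_thom refl])
      (simp add: map_fst_targs[OF assms(2)] len 1 2)
qed

lemma ext_differential_eq:
  assumes "\<gamma> \<in> HC n \<theta>"
  shows "ext_differential \<theta> \<gamma> as = (\<Sum>es | length es = length as. ops.Dif \<theta> (ev \<gamma>) (targs es as))"
  unfolding ext_differential_def by (intro sum.cong refl hom_differential_eq[OF assms]) simp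

lemma lin_Dif:
  assumes "\<gamma> \<in> HC n \<theta>" shows "lin (\<lambda>u. ops.Dif \<theta> (ev \<gamma>) (as @ u # bs))"
  by (intro cartan.multilinD cartan.Dif_multilin ev_multilin[OF assms])

lemma Dif_targs_eq_0:
  assumes "\<gamma> \<in> HC n \<theta>" "i < length as" "hcomp GR (es ! i) (as ! i) = 0"
  shows "ops.Dif \<theta> (ev \<gamma>) (targs es as) = 0"
proof -
  have "targs es as = take i (targs es as) @ (es ! i, 0, var i) # drop (Suc i) (targs es as)"
    using targs_update[OF assms(2), of es "as ! i"] assms(3) by simp
  moreover have "ops.Dif \<theta> (ev \<gamma>) (take i (targs es as) @ (es ! i, 0, var i) # drop (Suc i) (targs es as)) = 0"
    using additive.zero[OF linD(2)[OF lin_Dif[OF assms(1)]]] .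
  ultimately show ?thesis by metis
qed

text \<open>A degree list other than \<open>es\<close> selects the wrong component of some argument;
  that component is 0, and multilinearity removes the summand.\<close>

lemma ext_differential_hom:
  assumes "\<gamma> \<in> HC n \<theta>" "length es = length as" "\<And>i. i < length as \<Longrightarrow> as ! i \<in> GR (es ! i)"
  shows "ext_differential \<theta> \<gamma> as = ops.Dif \<theta> (ev \<gamma>) (targs es as)"
proof -
  have "ops.Dif \<theta> (ev \<gamma>) (targs es' as) = 0" if es': "length es' = length as" "es' \<noteq> es" for es'
  proof -
    obtain i where i: "i < length as" "es' ! i \<noteq> es ! i"
      using es' assms(2) nth_equalityI[of es' es] by metis
    then have "hcomp GR (es' ! i) (as ! i) = 0"
      using R.hcomp_hom[OF assms(3)[OF i(1)]] by simp
    then show ?thesis by (rule Dif_targs_eq_0[OF assms(1) i(1)])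
  qed
  then have "ext_differential \<theta> \<gamma> as = (\<Sum>es'\<in>{es}. ops.Dif \<theta> (ev \<gamma>) (targs es' as))"
    unfolding ext_differential_eq[OF assms(1)]
    using assms(2) by (intro sum.mono_neutral_right) (auto simp: finite_degree_lists)
  then show ?thesis by simp
qed

lemma targs_swap:
  assumes "Suc i < length as" "length es = length as"
  shows "map (tsubst (\<lambda>v. swap_at i (map var [0..<length as]) ! v)) (targs (swap_at i es) (swap_at i as))
    = swap_at i (targs es as)"
  using assms by (intro nth_equalityI) (auto simp: targs_def nth_swap_at tsubst_def)

text \<open>Each summand of the linear extension is skew with the sign of its own degrees at i and i
  + 1. This is the sign of d and e because summands with other degrees there vanish on both
  sides.\<close>

lemma ext_differential_skew:
  assumes \<gamma>: "\<gamma> \<in> HC n \<theta>" and i: "Suc i < length as" and as: "as ! i \<in> GR d" "as ! Suc i \<in> GR e"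
  shows "ext_differential \<theta> \<gamma> as = - sgn_if (d * e)
    (cochain_at smM (ext_differential \<theta> \<gamma>) (swap_at i (map var [0..<length as])) (swap_at i as))"
proof -
  let ?D = "ops.Dif \<theta> (ev \<gamma>)"
  let ?s = "\<lambda>v. swap_at i (map var [0..<length as]) ! v"
  have D: "?D (targs es as) = - sgn_if (d * e) (?D (swap_at i (targs es as)))" if len: "length es = length as" for es
  proof -
    obtain xs a b ys where t: "targs es as = xs @ a # b # ys" "length xs = i"
      using split_at_two[of i "targs es as"] i by auto
    have ab: "a = targs es as ! i" "b = targs es as ! Suc i"
      using t by (simp_all add: nth_append)
    have skew: "?D (targs es as) = - sgn_if (fst a * fst b) (?D (swap_at i (targs es as)))"
      using ops.skewD[OF cartan.Dif_skew[OF ev_skew[OF \<gamma>] ev_multilin[OF \<gamma>]], of xs a b ys \<theta>]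
        targs_thom[of es as] swap_at_append[of xs a b ys] t by simp
    have fst: "fst a = es ! i" "fst b = es ! Suc i"
      using i by (simp_all add: ab targs_def)
    show ?thesis
    proof (cases "es ! i = d \<and> es ! Suc i = e")
      case True
      then show ?thesis using skew fst by simp
    next
      case False
      \<comment> \<open>One of the two selected components is 0, so this value vanishes;
        \<open>skew\<close> carries the vanishing over to the exchanged list.\<close>
      then have "?D (targs es as) = 0"
        using Dif_targs_eq_0[OF \<gamma>, of i as es] Dif_targs_eq_0[OF \<gamma>, of "Suc i" as es] i
          R.hcomp_hom[OF as(1), of "es ! i"] R.hcomp_hom[OF as(2), of "es ! Suc i"] by auto
      moreover from this have "?D (swap_at i (targs es as)) = 0"
        using skew by (simp add: sgn_if_def split: if_splits)
      ultimately show ?thesis by simp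
    qed
  qed
  have "cochain_at smM (ext_differential \<theta> \<gamma>) (swap_at i (map var [0..<length as])) (swap_at i as) =
     (\<Sum>es | length es = length as. ?D (map (tsubst ?s) (targs es (swap_at i as))))"
    by (simp add: cochain_at_def ext_differential_eq[OF \<gamma>] additive.sum[OF M.additive_msubst] msubst_Dif_ev[OF \<gamma>])
  \<comment> \<open>The exchange is an involution on degree lists, so the sum may be reindexed to
    let the degrees follow their arguments.\<close>
  also have "\<dots> = (\<Sum>es | length es = length as. ?D (map (tsubst ?s) (targs (swap_at i es) (swap_at i as))))"
    using i by (intro sum.reindex_bij_witness[of _ "swap_at i" "swap_at i"]) (auto simp: swap_at_swap_at)
  also have "\<dots> = (\<Sum>es | length es = length as. ?D (swap_at i (targs es as)))"
    using i by (intro sum.cong refl arg_cong[of _ _ ?D] targs_swap) auto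
  finally have "- sgn_if (d * e) (cochain_at smM (ext_differential \<theta> \<gamma>) (swap_at i (map var [0..<length as])) (swap_at i as))
     = (\<Sum>es | length es = length as. - sgn_if (d * e) (?D (swap_at i (targs es as))))"
    by (simp add: sgn_if_sum sum_negf)
  also have "\<dots> = ext_differential \<theta> \<gamma> as"
    unfolding ext_differential_eq[OF \<gamma>] by (intro sum.cong refl) (simp add: D[symmetric])
  finally show ?thesis by simp
qed

lemma ext_differential_HC:
  assumes \<gamma>: "\<gamma> \<in> HC n \<theta>" shows "ext_differential \<theta> \<gamma> \<in> HC (Suc n) \<theta>"
  unfolding hom_cochains_def mem_Collect_eq
proof (intro conjI allI impI; (elim conjE)?)
  fix as :: "'r list" assume "length as \<noteq> Suc n"
  \<comment> \<open>\<open>Dif\<close> evaluates its function only at lists with one entry fewer,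
    and there \<open>ev \<gamma>\<close> is 0 unless their length is n.\<close>
  then have "ops.Dif \<theta> (ev \<gamma>) (targs es as) = ops.Dif \<theta> (\<lambda>_. 0) (targs es as)" for es
    by (intro ops.Dif_cong targs_thom) (auto simp: ev_length[OF \<gamma>])
  then show "ext_differential \<theta> \<gamma> as = 0"
    by (simp add: ext_differential_eq[OF \<gamma>])
next
  fix as :: "'r list" assume "length as = Suc n"
  then show "ext_differential \<theta> \<gamma> as \<in> mpolys_in (Suc n)"
    using Dif_gpolys[OF \<gamma> targs_ghom, of _ as] unfolding ext_differential_eq[OF \<gamma>]
    by (intro mpolys_in_sum) (simp add: M.gpolys_def)
next
  fix as :: "'r list" and i x y assume "length as = Suc n" "i < Suc n"
  then show "ext_differential \<theta> \<gamma> (as[i := x + y]) = ext_differential \<theta> \<gamma> (as[i := x]) + ext_differential \<theta> \<gamma> (as[i := y])"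
    by (simp add: ext_differential_eq[OF \<gamma>] targs_update R.hcomp_add additive.add[OF linD(2)[OF lin_Dif[OF \<gamma>]]] sum.distrib)
next
  fix as :: "'r list" and i c x assume "length as = Suc n" "i < Suc n"
  then show "ext_differential \<theta> \<gamma> (as[i := smR [:c:] x]) = mscale smM (cst c) (ext_differential \<theta> \<gamma> (as[i := x]))"
    by (simp add: ext_differential_eq[OF \<gamma>] targs_update R.hcomp_scale linD(3)[OF lin_Dif[OF \<gamma>]] M.mscale.scale_sum_right)
next
  fix as :: "'r list" and i x assume "length as = Suc n" "i < Suc n"
  then show "ext_differential \<theta> \<gamma> (as[i := smR [:0, 1:] x]) = - mscale smM (var i) (ext_differential \<theta> \<gamma> (as[i := x]))"
    by (simp add: ext_differential_eq[OF \<gamma>] targs_update R.hcomp_scale linD(4)[OF lin_Dif[OF \<gamma>]] M.mscale.scale_sum_right sum_negf)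
next
  fix as :: "'r list" and es k
  assume "length as = Suc n" "length es = Suc n" "\<forall>i<Suc n. as ! i \<in> GR (es ! i)"
  then show "Poly_Mapping.lookup (ext_differential \<theta> \<gamma> as) k \<in> GM (\<theta> + sum_list es)"
    using Dif_gpolys[OF \<gamma> targs_ghom, of es as]
    by (simp add: ext_differential_hom[OF \<gamma>, of es as] map_fst_targs M.gpolys_def)
next
  fix as :: "'r list" and i d e
  assume "length as = Suc n" "Suc i < Suc n" "as ! i \<in> GR d" "as ! Suc i \<in> GR e"
  then show "ext_differential \<theta> \<gamma> as = - sgn_if (d * e)
          (cochain_at smM (ext_differential \<theta> \<gamma>) ((map var [0..<Suc n])[i := var (Suc i), Suc i := var i])
             (as[i := as ! Suc i, Suc i := as ! i]))"
    using ext_differential_skew[OF \<gamma>, of i as d e] by (simp add: swap_at_def nth_append del: upt_Suc)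
qed

text \<open>Evaluation at pairs substitutes into the value at the variables, and the recursion
  commutes with this substitution. Iterating the differential thus becomes iterating
  \<open>Dif\<close>.\<close>

lemma ev_ext_differential:
  assumes \<gamma>: "\<gamma> \<in> HC n \<theta>" and ts: "set ts \<subseteq> thom"
  shows "ev (ext_differential \<theta> \<gamma>) ts = ops.Dif \<theta> (ev \<gamma>) ts"
proof -
  let ?es = "map fst ts" and ?as = "map (fst \<circ> snd) ts"
  let ?s = "\<lambda>v. map (snd \<circ> snd) ts ! v"
  have hom: "fst (snd (ts ! i)) \<in> GR (fst (ts ! i))" if "i < length ts" for i
  proof -
    have "ts ! i \<in> thom" using that ts nth_mem by blast
    then show ?thesis by (auto simp: thom_def)
  qed
  have "ext_differential \<theta> \<gamma> ?as = ops.Dif \<theta> (ev \<gamma>) (targs ?es ?as)"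
    using hom by (intro ext_differential_hom[OF \<gamma>]) simp_all
  then have "ev (ext_differential \<theta> \<gamma>) ts = msubst smM ?s (ops.Dif \<theta> (ev \<gamma>) (targs ?es ?as))"
    by (simp only: ev_def[of "ext_differential \<theta> \<gamma>"] cochain_at_def)
  also have "\<dots> = ops.Dif \<theta> (ev \<gamma>) (map (tsubst ?s) (targs ?es ?as))"
    by (rule msubst_Dif_ev[OF \<gamma>])
  also have "map (tsubst ?s) (targs ?es ?as) = ts"
    by (intro nth_equalityI) (simp_all add: targs_def tsubst_def R.hcomp_hom[OF hom])
  finally show ?thesis .
qed

lemma ext_differential_squared:
  assumes \<gamma>: "\<gamma> \<in> HC n \<theta>" shows "ext_differential \<theta> (ext_differential \<theta> \<gamma>) as = 0"
proof -
  have "ops.Dif \<theta> (ev (ext_differential \<theta> \<gamma>)) (targs es as) = ops.Dif \<theta> (ops.Dif \<theta> (ev \<gamma>)) (targs es as)" for es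
    by (intro ops.Dif_cong targs_thom ev_ext_differential[OF \<gamma>])
  also have "\<dots> es = 0" for es
    by (intro cartan.Dif_Dif targs_thom ev_multilin[OF \<gamma>])
  finally show ?thesis
    by (simp add: ext_differential_eq[OF ext_differential_HC[OF \<gamma>]])
qed

section \<open>Sums of two homogeneous cochains\<close>

lemma cochain_comp_eq:
  assumes \<gamma>: "\<gamma>0 \<in> HC n 0" "\<gamma>1 \<in> HC n 1"
  shows "cochain_comp GR GM \<theta> (\<lambda>as. \<gamma>0 as + \<gamma>1 as) as = (if \<theta> = 0 then \<gamma>0 else \<gamma>1) as"
proof -
  define \<gamma>' where "\<gamma>' = (if \<theta> = 0 then \<gamma>0 else \<gamma>1)"
  have \<gamma>': "\<gamma>' \<in> HC n \<theta>" using \<gamma> by (cases \<theta>) (simp_all add: \<gamma>'_def)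
  have "Poly_Mapping.map (hcomp GM (\<theta> + sum_list es)) (\<gamma>0 bs + \<gamma>1 bs) = \<gamma>' bs"
    if "length es = length as" "bs = map2 (hcomp GR) es as" for es bs
  proof (rule poly_mapping_eqI)
    fix k
    let ?c0 = "Poly_Mapping.lookup (\<gamma>0 bs) k" and ?c1 = "Poly_Mapping.lookup (\<gamma>1 bs) k"
    \<comment> \<open>At arguments of degrees \<open>es\<close> the two parts have values of
      opposite degree, so the projection to degree \<open>\<theta> + sum_list es\<close> keeps just
      one of them.\<close>
    have "?c0 \<in> GM (0 + sum_list es) \<and> ?c1 \<in> GM (1 + sum_list es)"
    proof (cases "length as = n")
      case True
      then show ?thesis
        using that by (intro conjI HC_graded[OF \<gamma>(1)] HC_graded[OF \<gamma>(2)]) (auto simp: R.hcomp_in)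
    next
      case False
      then show ?thesis
        using that HC_length[OF \<gamma>(1)] HC_length[OF \<gamma>(2)] M.subspace_0[OF M.subspace_G] by simp
    qed
    then have "hcomp GM (\<theta> + sum_list es) (?c0 + ?c1) = Poly_Mapping.lookup (\<gamma>' bs) k"
      by (cases \<theta>) (auto simp: M.hcomp_add M.hcomp_hom \<gamma>'_def)
    then show "Poly_Mapping.lookup (Poly_Mapping.map (hcomp GM (\<theta> + sum_list es)) (\<gamma>0 bs + \<gamma>1 bs)) k
        = Poly_Mapping.lookup (\<gamma>' bs) k"
      by (auto simp: Poly_Mapping.map.rep_eq lookup_add when_def)
  qed
  then have "cochain_comp GR GM \<theta> (\<lambda>as. \<gamma>0 as + \<gamma>1 as) as =
      (\<Sum>es | length es = length as. \<gamma>' (map2 (hcomp GR) es as))"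
    unfolding cochain_comp_def by (intro sum.cong refl) simp
  also have "\<dots> = \<gamma>' as"
    by (rule R.sum_hcomp) (rule HC_add[OF \<gamma>'])
  finally show ?thesis by (simp add: \<gamma>'_def)
qed

text \<open>A cochain is given as some sum of an even and an odd one; \<open>cochain_comp\<close>
  recovers precisely these summands, whichever way the sum was obtained.\<close>

lemma differential_eq:
  assumes "\<gamma>0 \<in> HC n 0" "\<gamma>1 \<in> HC n 1"
  shows "differential GR br smM GM rho (\<lambda>as. \<gamma>0 as + \<gamma>1 as) = (\<lambda>as. ext_differential 0 \<gamma>0 as + ext_differential 1 \<gamma>1 as)"
proof -
  have "cochain_comp GR GM 0 (\<lambda>as. \<gamma>0 as + \<gamma>1 as) = \<gamma>0" "cochain_comp GR GM 1 (\<lambda>as. \<gamma>0 as + \<gamma>1 as) = \<gamma>1"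
    using cochain_comp_eq[OF assms] by auto
  then show ?thesis
    by (intro ext) (simp add: differential_def ext_differential_def)
qed

lemma zero_HC: "(\<lambda>_. 0) \<in> HC n \<theta>"
  using M.subspace_0[OF M.subspace_G]
  by (simp add: hom_cochains_def mpolys_in_zero cochain_at_def additive.zero[OF M.additive_msubst])

lemma ext_differential_zero: "ext_differential \<theta> (\<lambda>_. 0) = (\<lambda>_. 0)"
proof
  fix as
  have "ev (\<lambda>_. 0) = (\<lambda>_. 0)"
    by (simp add: fun_eq_iff ev_def cochain_at_def additive.zero[OF M.additive_msubst])
  then show "ext_differential \<theta> (\<lambda>_. 0) as = 0"
    by (simp add: ext_differential_eq[OF zero_HC])
qed

lemma differential_cochains:
  assumes "\<gamma> \<in> cochains smR GR smM GM n"
  shows "differential GR br smM GM rho \<gamma> \<in> cochains smR GR smM GM (Suc n)"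
    and "differential GR br smM GM rho (differential GR br smM GM rho \<gamma>) = (\<lambda>_. 0)"
proof -
  obtain \<gamma>0 \<gamma>1 where \<gamma>: "\<gamma> = (\<lambda>as. \<gamma>0 as + \<gamma>1 as)" "\<gamma>0 \<in> HC n 0" "\<gamma>1 \<in> HC n 1"
    using assms by (auto simp: cochains_def)
  have d: "differential GR br smM GM rho \<gamma> = (\<lambda>as. ext_differential 0 \<gamma>0 as + ext_differential 1 \<gamma>1 as)"
    unfolding \<gamma>(1) by (rule differential_eq) fact+
  note ext_differential_HC[OF \<gamma>(2)] ext_differential_HC[OF \<gamma>(3)]
  then show "differential GR br smM GM rho \<gamma> \<in> cochains smR GR smM GM (Suc n)"
    unfolding d cochains_def by blast
  show "differential GR br smM GM rho (differential GR br smM GM rho \<gamma>) = (\<lambda>_. 0)"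
    unfolding d differential_eq[OF ext_differential_HC[OF \<gamma>(2)] ext_differential_HC[OF \<gamma>(3)]]
    by (simp add: ext_differential_squared[OF \<gamma>(2)] ext_differential_squared[OF \<gamma>(3)])
qed

text \<open>The zero cochain is homogeneous of both degrees, so a homogeneous cochain is the sum of
  itself and 0, in the order that \<open>\<theta>\<close> dictates.\<close>

lemma differential_HC:
  assumes \<gamma>: "\<gamma> \<in> HC n \<theta>"
  shows "differential GR br smM GM rho \<gamma> \<in> HC (Suc n) \<theta>"
proof -
  have "differential GR br smM GM rho \<gamma> = ext_differential \<theta> \<gamma>"
  proof (cases \<theta>)
    case zero
    then show ?thesis
      using differential_eq[of \<gamma> n "\<lambda>_. 0"] \<gamma> by (simp add: zero_HC ext_differential_zero)
  next
    case one
    then show ?thesis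
      using differential_eq[of "\<lambda>_. 0" n \<gamma>] \<gamma> by (simp add: zero_HC ext_differential_zero)
  qed
  then show ?thesis using ext_differential_HC[OF \<gamma>] by simp
qed

end

theorem proposition3p3:
  fixes smR :: "complex poly \<Rightarrow> 'r::ab_group_add \<Rightarrow> 'r" and GR :: "bit \<Rightarrow> 'r set"
    and br :: "'r \<Rightarrow> 'r \<Rightarrow> 'r poly"
    and smM :: "complex poly \<Rightarrow> 'm::ab_group_add \<Rightarrow> 'm" and GM :: "bit \<Rightarrow> 'm set"
    and rho :: "'r \<Rightarrow> 'm \<Rightarrow> 'm poly"
    and n :: nat and \<gamma> :: "('r, 'm) cochain"
  assumes "lie_conformal_superalgebra smR GR br"
    and "conformal_module smR GR br smM GM rho"
    and "\<gamma> \<in> cochains smR GR smM GM n"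
  shows "differential GR br smM GM rho \<gamma> \<in> cochains smR GR smM GM (Suc n) \<and>
    (\<forall>\<theta>. \<gamma> \<in> hom_cochains smR GR smM GM n \<theta> \<longrightarrow>
      differential GR br smM GM rho \<gamma> \<in> hom_cochains smR GR smM GM (Suc n) \<theta>) \<and>
    differential GR br smM GM rho (differential GR br smM GM rho \<gamma>) = (\<lambda>_. 0)"
proof -
  interpret conformal_module smR GR br smM GM rho by fact
  show ?thesis
    using differential_cochains[OF assms(3)] differential_HC by blast
qed

end
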